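(* Fix an integer $p\ge 2$ and let $\mu_n=\sqrt{p/n}\,\tau_n$ for all $n$, where the sequence $(\tau_n)$ in $\mathbb{R}^p$ is $O(1)$ but not $o(1)$. Let $f:\mathbb{R}\to\mathbb{R}^+$ be strictly increasing, differentiable at $0$ with $f(0)=f'(0)=1$, and twice differentiable at $0$. For any $\mu\in\mathbb{R}^p\setminus\{0\}$, let $\mathrm{P}^{(n)}_{\mu,f}:=\mathrm{P}^{(n)}_{\theta,\kappa,f}$, where $\mu=\kappa\theta$ with $\theta\in\mathcal{S}^{p-1}$ and $\kappa>0$. Then, as $n\to\infty$ under $\mathrm{P}^{(n)}_0$, $$ \log\frac{d\mathrm{P}^{(n)}_{\mu_n,f}}{d\mathrm{P}^{(n)}_0}=\tau_n'\Delta^{(n)}-\frac12\|\tau_n\|^2+o_{\mathrm{P}}(1), $$ where $\Delta^{(n)}:=\sqrt{np}\,\bar X_n$ is asymptotically standard $p$-variate normal.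
   Context: $\mathcal{S}^{p-1}=\{x\in\mathbb{R}^p:\|x\|=1\}$ is the unit sphere. For $\theta\in\mathcal{S}^{p-1}$, $\kappa>0$ and $f$ as in the claim, $\mathrm{P}^{(n)}_{\theta,\kappa,f}$ denotes the hypothesis (joint distribution) under which the random vectors $X_{n1},\ldots,X_{nn}$ are mutually independent and share the common density on $\mathcal{S}^{p-1}$, with respect to the surface area measure, proportional to $x\mapsto f(\kappa\,x'\theta)$. $\mathrm{P}^{(n)}_0$ denotes the hypothesis under which $X_{n1},\ldots,X_{nn}$ are i.i.d. uniform over $\mathcal{S}^{p-1}$; by convention it corresponds to $\mu=0$ (equivalently $\kappa=0$). $\bar X_n:=\frac1n\sum_{i=1}^nX_{ni}$. *)

theory Defs
  imports "HOL-Probability.Probability"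
begin

text \<open>
  Surface area measure on the unit sphere, by the polar-coordinate (cone) formula
  \<open>\<sigma> A = p * Leb {r x | 0 < r \<le> 1, x \<in> A}\<close>; this set is the preimage of \<open>A\<close> under
  \<open>x \<mapsto> x / norm x\<close> on the punctured unit ball. See \<open>emeasure_sphere_measure\<close> below.
\<close>

definition sphere_measure :: "'a::euclidean_space measure" where
  "sphere_measure =
     scale_measure (of_nat DIM('a))
       (distr (restrict_space lborel (cball 0 1 - {0}))
              (restrict_space borel (sphere 0 1)) (\<lambda>x. x /\<^sub>R norm x))"

text \<open>The laws of one observation, and the joint laws of \<open>X\<^sub>n\<^sub>1, \<dots>, X\<^sub>n\<^sub>n\<close>; the observations
  themselves are the coordinate maps \<open>\<lambda>\<omega>. \<omega> i\<close>, \<open>i \<in> {1..n}\<close>.\<close>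

definition sphere_unif :: "'a::euclidean_space measure" where
  "sphere_unif = uniform_measure sphere_measure (sphere 0 1)"

definition rot_law :: "'a::euclidean_space \<Rightarrow> real \<Rightarrow> (real \<Rightarrow> real) \<Rightarrow> 'a measure" where
  "rot_law \<theta> \<kappa> f =
     density sphere_measure
       (\<lambda>x. ennreal (f (\<kappa> * (x \<bullet> \<theta>)) / (\<integral>y. f (\<kappa> * (y \<bullet> \<theta>)) \<partial>sphere_measure)))"

definition P_null :: "nat \<Rightarrow> (nat \<Rightarrow> 'a::euclidean_space) measure" where
  "P_null n = PiM {1..n} (\<lambda>_. sphere_unif)"

definition P_rot :: "nat \<Rightarrow> 'a::euclidean_space \<Rightarrow> real \<Rightarrow> (real \<Rightarrow> real) \<Rightarrow> (nat \<Rightarrow> 'a) measure" where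
  "P_rot n \<theta> \<kappa> f = PiM {1..n} (\<lambda>_. rot_law \<theta> \<kappa> f)"

text \<open>For \<open>\<mu> \<noteq> 0\<close>, \<open>\<mu> = \<kappa> \<theta>\<close> with \<open>\<kappa> > 0\<close> and \<open>norm \<theta> = 1\<close> forces the \<open>\<kappa>\<close> and \<open>\<theta>\<close> used here;
  \<open>\<mu> = 0\<close> is the null hypothesis by convention.\<close>

definition P_loc :: "nat \<Rightarrow> 'a::euclidean_space \<Rightarrow> (real \<Rightarrow> real) \<Rightarrow> (nat \<Rightarrow> 'a) measure" where
  "P_loc n \<mu> f = (if \<mu> = 0 then P_null n else P_rot n (\<mu> /\<^sub>R norm \<mu>) (norm \<mu>) f)"

definition sample_mean :: "nat \<Rightarrow> (nat \<Rightarrow> 'a::real_vector) \<Rightarrow> 'a" where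
  "sample_mean n \<omega> = (1 / real n) *\<^sub>R (\<Sum>i\<in>{1..n}. \<omega> i)"

definition Delta :: "nat \<Rightarrow> (nat \<Rightarrow> 'a::euclidean_space) \<Rightarrow> 'a" where
  "Delta n \<omega> = sqrt (real n * real DIM('a)) *\<^sub>R sample_mean n \<omega>"

definition log_likelihood_ratio :: "'b measure \<Rightarrow> 'b measure \<Rightarrow> 'b \<Rightarrow> real" where
  "log_likelihood_ratio M N \<omega> = ln (enn2real (RN_deriv N M \<omega>))"

definition small_oP1 :: "(nat \<Rightarrow> 'b measure) \<Rightarrow> (nat \<Rightarrow> 'b \<Rightarrow> real) \<Rightarrow> bool" where
  "small_oP1 M Z \<longleftrightarrow>
     (\<forall>n. Z n \<in> borel_measurable (M n)) \<and>
     (\<forall>\<epsilon>>0. (\<lambda>n. measure (M n) {\<omega> \<in> space (M n). \<bar>Z n \<omega>\<bar> > \<epsilon>}) \<longlonglongrightarrow> 0)"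

text \<open>\<open>weak_conv\<close> in the library is restricted to measures on \<open>real\<close>.\<close>

definition weak_conv_to :: "(nat \<Rightarrow> 'a::topological_space measure) \<Rightarrow> 'a measure \<Rightarrow> bool" where
  "weak_conv_to M N \<longleftrightarrow>
     (\<forall>g::'a \<Rightarrow> real. continuous_on UNIV g \<longrightarrow> bounded (range g) \<longrightarrow>
        (\<lambda>n. \<integral>x. g x \<partial>M n) \<longlonglongrightarrow> (\<integral>x. g x \<partial>N))"

definition std_mvn :: "'a::euclidean_space measure" where
  "std_mvn = density lborel (\<lambda>x. ennreal (\<Prod>b\<in>Basis. std_normal_density (x \<bullet> b)))"

lemma space_sphere_measure [simp]: "space sphere_measure = sphere 0 1"
  by (simp add: sphere_measure_def space_scale_measure space_restrict_space)

lemma sets_sphere_measure [measurable_cong, simp]: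
  "sets sphere_measure = sets (restrict_space borel (sphere 0 1))"
  by (simp add: sphere_measure_def)

lemma emeasure_sphere_measure:
  fixes A :: "'a::euclidean_space set"
  assumes "A \<in> sets borel" "A \<subseteq> sphere 0 1"
  shows "emeasure sphere_measure A =
    of_nat DIM('a) * emeasure lborel {r *\<^sub>R x | r x. 0 < r \<and> r \<le> 1 \<and> x \<in> A}"
proof -
  let ?B = "cball 0 1 - {0::'a}"
  let ?g = "\<lambda>x::'a. x /\<^sub>R norm x"
  have g: "?g \<in> measurable (restrict_space lborel ?B) (restrict_space borel (sphere 0 1))"
    by (intro measurable_restrict_space2 measurable_restrict_space1)
       (auto simp: space_restrict_space)
  have A: "A \<in> sets (restrict_space borel (sphere 0 1))"
    using assms by (auto simp: sets_restrict_space_iff)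
  have "?g -` A \<inter> space (restrict_space lborel ?B) = {r *\<^sub>R x | r x. 0 < r \<and> r \<le> 1 \<and> x \<in> A}"
    (is "?L = ?R")
  proof
    show "?L \<subseteq> ?R"
    proof
      fix x assume x: "x \<in> ?L"
      then have "x = norm x *\<^sub>R ?g x" "0 < norm x" "norm x \<le> 1" "?g x \<in> A"
        by (auto simp: space_restrict_space)
      then show "x \<in> ?R" by blast
    qed
    show "?R \<subseteq> ?L"
      using assms(2) by (fastforce simp: space_restrict_space)
  qed
  moreover have "emeasure (restrict_space lborel ?B) ?L = emeasure lborel ?L"
    by (rule emeasure_restrict_space) (auto simp: space_restrict_space)
  ultimately show ?thesis
    using g A by (simp add: sphere_measure_def emeasure_distr)
qed

lemma emeasure_sphere_measure_space:
  "emeasure sphere_measure (sphere 0 1 :: 'a::euclidean_space set) =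
     ennreal (real DIM('a) * measure lborel (cball 0 1 :: 'a set))"
proof -
  have "{r *\<^sub>R x | r x. 0 < r \<and> r \<le> 1 \<and> x \<in> sphere 0 1} = cball 0 1 - {0::'a}" (is "?L = ?R")
  proof
    show "?R \<subseteq> ?L"
    proof
      fix x :: 'a assume x: "x \<in> ?R"
      then have "x = norm x *\<^sub>R (x /\<^sub>R norm x)" "0 < norm x" "norm x \<le> 1"
        "x /\<^sub>R norm x \<in> sphere 0 1" by auto
      then show "x \<in> ?L" by blast
    qed
  qed auto
  moreover have "emeasure lborel (cball 0 1 - {0::'a}) = emeasure lborel (cball 0 1 :: 'a set)"
    by (subst emeasure_Diff) auto
  moreover have "emeasure lborel (cball 0 1 :: 'a set) = ennreal (measure lborel (cball 0 1 :: 'a set))"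
    using emeasure_lborel_cball_finite[of "0::'a" 1] by (intro emeasure_eq_ennreal_measure) auto
  ultimately show ?thesis
    by (subst emeasure_sphere_measure)
       (auto simp: ennreal_mult ennreal_of_nat_eq_real_of_nat)
qed

lemma prob_space_sphere_unif: "prob_space (sphere_unif :: 'a::euclidean_space measure)"
  unfolding sphere_unif_def
proof (rule prob_space_uniform_measure)
  show "emeasure sphere_measure (sphere 0 1 :: 'a set) \<noteq> 0"
    by (simp add: emeasure_sphere_measure_space ennreal_eq_0_iff not_le content_cball_pos)
qed (simp add: emeasure_sphere_measure_space)

lemma prob_space_P_null: "prob_space (P_null n)"
  unfolding P_null_def by (intro prob_space_PiM prob_space_sphere_unif)

end

theory Submission
  imports Defs "HOL-Combinatorics.Transposition" "HOL-Real_Asymp.Real_Asymp"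
begin

text \<open>
  Under the uniform law, \<open>u \<bullet> X\<close> has mean \<open>0\<close> and variance \<open>|u|\<^sup>2 / p\<close>, because Lebesgue measure is
  invariant under reflecting and swapping coordinates. With \<open>a = f''(0)\<close>, second-order expansions of
  \<open>f\<close> and \<open>ln f\<close> at \<open>0\<close> give \<open>n ln E f(\<mu>\<^sub>n \<bullet> X) = a |\<tau>\<^sub>n|\<^sup>2 / 2 + o(1)\<close> for the normalising constant
  and \<open>\<Sum> ln f(\<mu>\<^sub>n \<bullet> X\<^sub>i) = \<tau>\<^sub>n \<bullet> \<Delta> + (a - 1)/2 \<Sum> (\<mu>\<^sub>n \<bullet> X\<^sub>i)\<^sup>2 + o(1)\<close>; by Chebyshev the last sum is
  \<open>|\<tau>\<^sub>n|\<^sup>2 + o\<^sub>P(1)\<close>, and \<open>a\<close> cancels. Normality of \<open>\<Delta>\<close>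
  follows from pointwise convergence of characteristic functions and tightness, by approximating bounded
  continuous functions with trigonometric sums.
\<close>

section \<open>The uniform law on the sphere\<close>

text \<open>On the sphere \<open>\<bar>u \<bullet> x\<bar> \<le> norm u\<close>, and
  \<open>norm (\<mu> n)\<close> tends to 0, so for large n all observations lie surely, and not just
  with high probability, in any prescribed neighbourhood of 0. A second derivative at 0 alone yields
  only Peano remainders, of size at most \<open>\<eta> * t\<^sup>2\<close> near 0; these therefore
  apply to the whole sample at once, and since n times \<open>(norm (\<mu> n))\<^sup>2\<close>
  equals p times \<open>(norm (\<tau> n))\<^sup>2\<close>, which stays bounded, n of them add up to
  a multiple of \<open>\<eta>\<close>. Randomness is left only in the centred sum of squares. The
  symmetries of Lebesgue measure reach the sphere because the surface measure is a radial image of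
  Lebesgue measure on the ball. For normality, the same boundedness of the observations gives a
  cubic error bound for the characteristic function. The passage to bounded continuous functions
  needs approximants that stay bounded on the whole space: outside a large ball only the smallness
  of the tail mass is available.\<close>

lemma lborel_reflect_Basis:
  fixes i :: "'a::euclidean_space"
  assumes i: "i \<in> Basis"
  shows "distr lborel borel (\<lambda>x. x - (2 * (x \<bullet> i)) *\<^sub>R i) = lborel"
proof -
  define c where "c j = (if j = i then -1 else 1::real)" for j
  \<comment> \<open>In diagonal affine form, with factor -1 on \<open>i\<close> and 1 elsewhere, the
    Jacobian density is the product of the absolute factors, hence 1.\<close>
  have T: "x - (2 * (x \<bullet> i)) *\<^sub>R i = 0 + (\<Sum>j\<in>Basis. (c j * (x \<bullet> j)) *\<^sub>R j)" for x
    by (rule euclidean_eqI) (use i in \<open>auto simp: c_def inner_diff_left inner_Basis\<close>)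
  have "(\<Prod>j\<in>Basis. \<bar>c (j::'a)\<bar>) = 1"
    by (rule prod.neutral) (auto simp: c_def)
  then show ?thesis
    using lborel_affine_euclidean[of c 0] unfolding T
    by (simp add: c_def density_1)
qed

text \<open>A transposition is not diagonal in the basis, so boxes are used instead: since it is an
  involution, the preimage of \<open>box l u\<close> is \<open>box (T l) (T u)\<close>, and the two
  volumes are the same product in a different order.\<close>

lemma lborel_swap_Basis:
  fixes i j :: "'a::euclidean_space"
  assumes i: "i \<in> Basis" and j: "j \<in> Basis"
  defines "T \<equiv> \<lambda>x. \<Sum>b\<in>Basis. (x \<bullet> Transposition.transpose i j b) *\<^sub>R b"
  shows "distr lborel borel T = lborel"
proof (rule lborel_eqI[symmetric])
  let ?\<pi> = "Transposition.transpose i j"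
  have \<pi>: "?\<pi> b \<in> Basis" if "b \<in> Basis" for b
    using that i j by (auto simp: Transposition.transpose_def)
  have img: "?\<pi> ` Basis = Basis"
    using i j by (simp add: transpose_image_eq)
  have [measurable]: "T \<in> borel \<rightarrow>\<^sub>M borel"
    unfolding T_def by measurable
  have Tb: "T x \<bullet> b = x \<bullet> ?\<pi> b" if "b \<in> Basis" for x b
    using that by (simp add: T_def inner_sum_left inner_Basis if_distrib sum.delta cong: if_cong)
  fix l u :: 'a assume le: "\<And>b. b \<in> Basis \<Longrightarrow> l \<bullet> b \<le> u \<bullet> b"
  have "(T x \<in> box l u) \<longleftrightarrow> x \<in> box (T l) (T u)" for x
  proof -
    have "(T x \<in> box l u) \<longleftrightarrow> (\<forall>b\<in>Basis. l \<bullet> b < x \<bullet> ?\<pi> b \<and> x \<bullet> ?\<pi> b < u \<bullet> b)"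
      by (simp add: mem_box Tb)
    also have "\<dots> \<longleftrightarrow> (\<forall>b\<in>?\<pi> ` Basis. l \<bullet> ?\<pi> b < x \<bullet> b \<and> x \<bullet> b < u \<bullet> ?\<pi> b)"
      by simp
    also have "\<dots> \<longleftrightarrow> x \<in> box (T l) (T u)"
      unfolding img by (simp add: mem_box Tb)
    finally show ?thesis .
  qed
  then have "T -` box l u = box (T l) (T u)" by auto
  then have "emeasure (distr lborel borel T) (box l u) = emeasure lborel (box (T l) (T u))"
    by (simp add: emeasure_distr)
  also have "\<dots> = (\<Prod>b\<in>Basis. (T u - T l) \<bullet> b)"
    by (simp add: emeasure_lborel_box_eq inner_diff_left Tb le \<pi>)
  also have "(\<Prod>b\<in>Basis. (T u - T l) \<bullet> b) = (\<Prod>b\<in>Basis. (u - l) \<bullet> ?\<pi> b)"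
    by (simp add: inner_diff_left Tb)
  also have "\<dots> = (\<Prod>b\<in>?\<pi> ` Basis. (u - l) \<bullet> b)"
    by (subst prod.reindex) (auto simp: inj_on_def transpose_eq_iff)
  finally show "emeasure (distr lborel borel T) (box l u) = (\<Prod>b\<in>Basis. (u - l) \<bullet> b)"
    unfolding img .
qed simp

section \<open>From symmetries of Lebesgue measure to symmetries of the sphere\<close>

lemma nn_integral_sphere_measure:
  fixes h :: "'a::euclidean_space \<Rightarrow> ennreal"
  assumes [measurable]: "h \<in> borel_measurable borel"
  shows "(\<integral>\<^sup>+x. h x \<partial>sphere_measure) =
    of_nat DIM('a) * (\<integral>\<^sup>+x. h (x /\<^sub>R norm x) * indicator (cball 0 1 - {0}) x \<partial>lborel)"
proof -
  have g: "(\<lambda>x::'a. x /\<^sub>R norm x) \<in> measurable (restrict_space lborel (cball 0 1 - {0})) (restrict_space borel (sphere 0 1))"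
    by (intro measurable_restrict_space2 measurable_restrict_space1)
       (auto simp: space_restrict_space)
  have h: "h \<in> borel_measurable (restrict_space borel (sphere 0 1))"
    by (intro measurable_restrict_space1) simp
  show ?thesis
    unfolding sphere_measure_def using g h
    by (subst nn_integral_scale_measure)
      (auto simp: nn_integral_distr nn_integral_restrict_space)
qed

lemma sets_sphere_unif [measurable_cong, simp]:
  "sets sphere_unif = sets (restrict_space borel (sphere 0 1))"
  by (simp add: sphere_unif_def)

lemma space_sphere_unif [simp]: "space sphere_unif = sphere 0 1"
  by (simp add: sphere_unif_def)

lemma borel_measurable_sphere_unif:
  assumes "h \<in> borel \<rightarrow>\<^sub>M M"
  shows "h \<in> sphere_unif \<rightarrow>\<^sub>M M"
  using measurable_restrict_space1[OF assms, of "sphere 0 1"]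
  by (simp cong: measurable_cong_sets)

text \<open>A linear norm-preserving \<open>T\<close> commutes with the radial projection and maps
  the punctured ball to itself, so the integrand over the ball can be written as a function of
  \<open>T x\<close>. Invariance of \<open>lborel\<close> then passes to
  \<open>sphere_measure\<close>, and from there to its normalisation.\<close>

lemma integral_sphere_unif_isometry:
  fixes T :: "'a::euclidean_space \<Rightarrow> 'a" and h :: "'a \<Rightarrow> real"
  assumes T: "linear T" "\<And>x. norm (T x) = norm x" and inv: "distr lborel borel T = lborel"
    and h: "h \<in> borel_measurable borel"
  shows "(\<integral>x. h (T x) \<partial>sphere_unif) = (\<integral>x. h x \<partial>sphere_unif)"
proof -
  have T_meas [measurable]: "T \<in> borel \<rightarrow>\<^sub>M borel"
    using T(1) by (intro borel_measurable_continuous_onI linear_continuous_on linear_linear[THEN iffD1])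
      (simp add: linear_conv_bounded_linear)
  have T_sph: "T \<in> measurable sphere_measure sphere_measure"
    using measurable_restrict_space3[OF T_meas, of "sphere 0 1" "sphere 0 1"] T(2)
    by (simp cong: measurable_cong_sets)
  have T_unif: "T \<in> measurable sphere_unif sphere_unif"
    using measurable_restrict_space3[OF T_meas, of "sphere 0 1" "sphere 0 1"] T(2)
    by (simp cong: measurable_cong_sets)
  have ball: "(\<lambda>x. indicator A (x /\<^sub>R norm x) * indicator (cball 0 1 - {0}) x :: ennreal) \<in> borel_measurable borel"
    if [measurable]: "A \<in> sets borel" for A :: "'a set"
  proof -
    have [measurable]: "cball 0 1 - {0::'a} \<in> sets borel" by auto
    show ?thesis by measurable
  qed
  have "distr sphere_measure sphere_measure T = sphere_measure"
  proof (rule measure_eqI)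
    fix A assume "A \<in> sets (distr sphere_measure sphere_measure T)"
    then have A: "A \<in> sets sphere_measure" and [measurable]: "A \<in> sets borel"
      by (auto simp: sets_restrict_space_iff)
    have "emeasure (distr sphere_measure sphere_measure T) A = (\<integral>\<^sup>+x. indicator A x \<partial>distr sphere_measure sphere_measure T)"
      using A by simp
    also have "\<dots> = (\<integral>\<^sup>+x. indicator A (T x) \<partial>sphere_measure)"
      using A by (intro nn_integral_distr T_sph) auto
    also have "\<dots> = of_nat DIM('a) * (\<integral>\<^sup>+x. indicator A (T (x /\<^sub>R norm x)) * indicator (cball 0 1 - {0}) x \<partial>lborel)"
      by (rule nn_integral_sphere_measure) measurable
    also have "(\<integral>\<^sup>+x. indicator A (T (x /\<^sub>R norm x)) * indicator (cball 0 1 - {0}) x \<partial>lborel)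
        = (\<integral>\<^sup>+x. indicator A (T x /\<^sub>R norm (T x)) * indicator (cball 0 1 - {0}) (T x) \<partial>lborel)"
    proof (intro nn_integral_cong)
      fix x
      have "T x = 0 \<longleftrightarrow> x = 0" by (metis T(2) norm_eq_zero)
      then show "indicator A (T (x /\<^sub>R norm x)) * indicator (cball 0 1 - {0}) x =
        (indicator A (T x /\<^sub>R norm (T x)) * indicator (cball 0 1 - {0}) (T x) :: ennreal)"
        using T by (simp add: linear_scale indicator_def)
    qed
    also have "\<dots> = (\<integral>\<^sup>+x. indicator A (x /\<^sub>R norm x) * indicator (cball 0 1 - {0}) x \<partial>distr lborel borel T)"
      by (rule nn_integral_distr[symmetric]) (auto simp: ball)
    also have "of_nat DIM('a) * \<dots> = (\<integral>\<^sup>+x. indicator A x \<partial>sphere_measure)"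
      unfolding inv by (rule nn_integral_sphere_measure[symmetric]) measurable
    finally show "emeasure (distr sphere_measure sphere_measure T) A = emeasure sphere_measure A"
      using A by simp
  qed simp
  then have sph: "emeasure sphere_measure (T -` A \<inter> sphere 0 1) = emeasure sphere_measure A"
    if "A \<in> sets sphere_measure" for A
    using that T_sph by (metis emeasure_distr space_sphere_measure)
  have "distr sphere_unif sphere_unif T = sphere_unif"
  proof (rule measure_eqI)
    fix A assume "A \<in> sets (distr sphere_unif sphere_unif T)"
    then have A: "A \<in> sets sphere_measure" "A \<in> sets sphere_unif" "A \<subseteq> sphere 0 1"
      by (auto simp: sets_restrict_space)
    have TA: "T -` A \<inter> sphere 0 1 \<in> sets sphere_measure"
      using T_sph A(1) by (metis measurable_sets space_sphere_measure)
    have S: "sphere 0 1 \<in> sets (sphere_measure :: 'a measure)"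
      using sets.top[of "sphere_measure :: 'a measure"] by (simp only: space_sphere_measure)
    have "emeasure (distr sphere_unif sphere_unif T) A = emeasure sphere_unif (T -` A \<inter> sphere 0 1)"
      using A(2) T_unif by (simp add: emeasure_distr)
    also have "\<dots> = emeasure sphere_unif A"
      using A TA S sph[OF A(1)] unfolding sphere_unif_def
      by (simp add: emeasure_uniform_measure Int_absorb1 Int_absorb2 Int_commute del: sets_sphere_measure)
    finally show "emeasure (distr sphere_unif sphere_unif T) A = emeasure sphere_unif A" .
  qed simp
  then show ?thesis
    using integral_distr[OF T_unif borel_measurable_sphere_unif[OF h]] by simp
qed

interpretation U: prob_space "sphere_unif :: 'a::euclidean_space measure"
  by (rule prob_space_sphere_unif)

lemma integrable_sphere_unif:
  fixes h :: "'a::euclidean_space \<Rightarrow> 'b::{banach,second_countable_topology}"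
  assumes "h \<in> borel_measurable borel" and "\<And>x. norm x = 1 \<Longrightarrow> norm (h x) \<le> B"
  shows "integrable sphere_unif h"
  using assms by (intro U.integrable_const_bound[where B=B] borel_measurable_sphere_unif) auto

lemma integral_sphere_unif_mono:
  fixes g h :: "'a::euclidean_space \<Rightarrow> real"
  assumes "integrable sphere_unif g" "integrable sphere_unif h" "\<And>x. norm x = 1 \<Longrightarrow> g x \<le> h x"
  shows "(\<integral>x. g x \<partial>sphere_unif) \<le> (\<integral>x. h x \<partial>sphere_unif)"
  using assms by (intro integral_mono) auto

lemma abs_inner_sphere_le: "norm x = 1 \<Longrightarrow> \<bar>u \<bullet> x\<bar> \<le> norm u" for x :: "'a::real_inner"
  using Cauchy_Schwarz_ineq2[of u x] by simp

section \<open>Mean and covariance of a uniform point on the sphere\<close>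

lemma integral_sphere_unif_inner:
  fixes u :: "'a::euclidean_space"
  shows "(\<integral>x. u \<bullet> x \<partial>sphere_unif) = 0"
proof -
  have inv: "distr lborel borel (\<lambda>x. - x :: 'a) = lborel"
    using lborel_affine_euclidean[of "\<lambda>_. -1" "0::'a"]
    by (simp add: sum_negf euclidean_representation density_1)
  have "(\<integral>x. u \<bullet> (- x) \<partial>sphere_unif) = (\<integral>x. u \<bullet> x \<partial>sphere_unif)"
    by (rule integral_sphere_unif_isometry[OF _ _ inv]) (auto simp: linear_uminus)
  then show ?thesis by simp
qed

text \<open>Reflecting coordinate \<open>i\<close> changes the sign of a mixed product, so mixed
  moments vanish. Swapping coordinates makes all second moments equal; as the squares of the
  coordinates add up to 1, each moment is the reciprocal of the dimension.\<close>

lemma integral_sphere_unif_Basis: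
  fixes i j :: "'a::euclidean_space"
  assumes i: "i \<in> Basis" and j: "j \<in> Basis"
  shows "(\<integral>x. (x \<bullet> i) * (x \<bullet> j) \<partial>sphere_unif) = (if i = j then 1 / DIM('a) else 0)"
proof (cases "i = j")
  case False
  define T where "T x = x - (2 * (x \<bullet> i)) *\<^sub>R i" for x :: 'a
  have "i \<bullet> i = 1" using i by (simp add: inner_Basis)
  then have "norm (T x) = norm x" for x
    by (simp add: T_def norm_eq_sqrt_inner algebra_simps inner_commute)
  moreover have "linear T"
    unfolding T_def by (intro linearI) (auto simp: algebra_simps)
  moreover have "distr lborel borel T = lborel"
    using lborel_reflect_Basis[OF i] unfolding T_def .
  ultimately have "(\<integral>x. (T x \<bullet> i) * (T x \<bullet> j) \<partial>sphere_unif) = (\<integral>x. (x \<bullet> i) * (x \<bullet> j) \<partial>sphere_unif)"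
    by (intro integral_sphere_unif_isometry[of T "\<lambda>x. (x \<bullet> i) * (x \<bullet> j)"]) auto
  moreover have "(T x \<bullet> i) * (T x \<bullet> j) = - ((x \<bullet> i) * (x \<bullet> j))" for x
    using i j False by (simp add: T_def inner_diff_left inner_Basis)
  ultimately show ?thesis using False by simp
next
  case True
  have eq: "(\<integral>x. (x \<bullet> b)\<^sup>2 \<partial>sphere_unif) = (\<integral>x. (x \<bullet> i)\<^sup>2 \<partial>sphere_unif)" if b: "b \<in> Basis" for b :: 'a
  proof -
    define T where "T x = (\<Sum>k\<in>Basis. (x \<bullet> Transposition.transpose b i k) *\<^sub>R k)" for x :: 'a
    have Tk: "T x \<bullet> k = x \<bullet> Transposition.transpose b i k" if "k \<in> Basis" for x k
      using that by (simp add: T_def inner_sum_left inner_Basis if_distrib sum.delta cong: if_cong)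
    have img: "Transposition.transpose b i ` Basis = Basis"
      using i b by (simp add: transpose_image_eq)
    have "(\<Sum>k\<in>Basis. (x \<bullet> Transposition.transpose b i k)\<^sup>2) = (\<Sum>k\<in>Transposition.transpose b i ` Basis. (x \<bullet> k)\<^sup>2)" for x
      by (subst sum.reindex) (auto simp: inj_on_def transpose_eq_iff)
    then have "norm (T x) = norm x" for x
      by (simp add: norm_eq_sqrt_inner euclidean_inner[of "T x" "T x"] euclidean_inner[of x x]
          Tk img flip: power2_eq_square)
    moreover have "linear T"
      unfolding T_def by (intro linearI) (auto simp: algebra_simps sum.distrib scaleR_sum_right)
    moreover have "distr lborel borel T = lborel"
      using lborel_swap_Basis[OF b i] unfolding T_def .
    ultimately have "(\<integral>x. (T x \<bullet> i)\<^sup>2 \<partial>sphere_unif) = (\<integral>x. (x \<bullet> i)\<^sup>2 \<partial>sphere_unif)"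
      by (intro integral_sphere_unif_isometry[of T "\<lambda>x. (x \<bullet> i)\<^sup>2"]) auto
    then show ?thesis by (simp add: Tk i)
  qed
  have "real DIM('a) * (\<integral>x. (x \<bullet> i)\<^sup>2 \<partial>sphere_unif) = (\<Sum>b\<in>(Basis::'a set). \<integral>x. (x \<bullet> b)\<^sup>2 \<partial>sphere_unif)"
    by (simp add: eq)
  also have "\<dots> = (\<integral>x. (\<Sum>b\<in>(Basis::'a set). (x \<bullet> b)\<^sup>2) \<partial>sphere_unif)"
  proof (rule Bochner_Integration.integral_sum[symmetric])
    fix b :: 'a assume b: "b \<in> Basis"
    show "integrable sphere_unif (\<lambda>x. (x \<bullet> b)\<^sup>2)"
      using b abs_inner_sphere_le[of _ b]
      by (intro integrable_sphere_unif[where B=1]) (auto simp: inner_commute abs_le_square_iff[of _ 1, simplified])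
  qed
  also have "\<dots> = (\<integral>x. 1 \<partial>(sphere_unif :: 'a measure))"
  proof (rule Bochner_Integration.integral_cong)
    fix x :: 'a assume "x \<in> space sphere_unif"
    then have "x \<bullet> x = 1" by (simp add: dot_square_norm)
    then show "(\<Sum>b\<in>(Basis::'a set). (x \<bullet> b)\<^sup>2) = 1"
      by (simp add: euclidean_inner[of x x] power2_eq_square)
  qed simp
  finally have "real DIM('a) * (\<integral>x. (x \<bullet> i)\<^sup>2 \<partial>sphere_unif) = 1"
    using U.prob_space[where 'a='a] by simp
  with True show ?thesis by (simp add: power2_eq_square field_simps)
qed

lemma integral_sphere_unif_inner_power2:
  fixes u :: "'a::euclidean_space"
  shows "(\<integral>x. (u \<bullet> x)\<^sup>2 \<partial>sphere_unif) = (norm u)\<^sup>2 / DIM('a)"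
proof -
  have int: "integrable sphere_unif (\<lambda>x. (x \<bullet> i) * (x \<bullet> j))" if "i \<in> Basis" "j \<in> Basis" for i j :: 'a
  proof (rule integrable_sphere_unif[where B="1*1"])
    fix x :: 'a assume "norm x = 1"
    with that show "norm ((x \<bullet> i) * (x \<bullet> j)) \<le> 1 * 1"
      unfolding norm_mult using abs_inner_sphere_le[of x i] abs_inner_sphere_le[of x j]
      by (intro mult_mono) (auto simp: inner_commute)
  qed simp
  have "(u \<bullet> x)\<^sup>2 = (\<Sum>i\<in>Basis. \<Sum>j\<in>Basis. (u \<bullet> i) * (u \<bullet> j) * ((x \<bullet> i) * (x \<bullet> j)))" for x
    by (simp add: power2_eq_square euclidean_inner[of u x] sum_product ac_simps)
  then have "(\<integral>x. (u \<bullet> x)\<^sup>2 \<partial>sphere_unif) = (\<Sum>i\<in>Basis. \<Sum>j\<in>Basis. (u \<bullet> i) * (u \<bullet> j) * (\<integral>x. (x \<bullet> i) * (x \<bullet> j) \<partial>sphere_unif))"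
    using int by (simp add: Bochner_Integration.integral_sum)
  also have "\<dots> = (\<Sum>i\<in>Basis. (u \<bullet> i)\<^sup>2 / DIM('a))"
    by (simp add: integral_sphere_unif_Basis if_distrib sum.delta power2_eq_square cong: if_cong)
  also have "\<dots> = (norm u)\<^sup>2 / DIM('a)"
    unfolding power2_norm_eq_inner euclidean_inner[of u u]
    by (simp add: sum_divide_distrib power2_eq_square)
  finally show ?thesis .
qed

section \<open>Likelihood ratios for i.i.d. samples\<close>

lemma measurable_P_null_component:
  assumes "i \<in> {1..n}" "h \<in> borel \<rightarrow>\<^sub>M N"
  shows "(\<lambda>\<omega>. h (\<omega> i)) \<in> P_null n \<rightarrow>\<^sub>M N"
  unfolding P_null_def
  by (rule measurable_PiM_component_rev[OF assms(1) borel_measurable_sphere_unif[OF assms(2)]])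

lemma space_P_null_norm: "\<omega> \<in> space (P_null n) \<Longrightarrow> i \<in> {1..n} \<Longrightarrow> norm (\<omega> i) = 1"
  unfolding P_null_def space_PiM by (auto simp: PiE_iff)

interpretation P: prob_space "P_null n :: (nat \<Rightarrow> 'a::euclidean_space) measure" for n
  by (rule prob_space_P_null)

interpretation US: product_sigma_finite "\<lambda>_::nat. sphere_unif :: 'a::euclidean_space measure"
  by (simp add: product_sigma_finite_def U.sigma_finite_measure_axioms)

text \<open>Independence together with mean zero removes the cross terms of the expanded
  square.\<close>

lemma
  fixes h :: "'a::euclidean_space \<Rightarrow> real"
  assumes h: "h \<in> borel_measurable borel" and B: "\<And>x. norm x = 1 \<Longrightarrow> \<bar>h x\<bar> \<le> B"
    and mean: "(\<integral>x. h x \<partial>sphere_unif) = 0"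
  shows integrable_P_null_sum_power2: "integrable (P_null n) (\<lambda>\<omega>. (\<Sum>i\<in>{1..n}. h (\<omega> i))\<^sup>2)"
    and integral_P_null_sum_power2:
      "(\<integral>\<omega>. (\<Sum>i\<in>{1..n}. h (\<omega> i))\<^sup>2 \<partial>P_null n) = real n * (\<integral>x. (h x)\<^sup>2 \<partial>sphere_unif)"
proof -
  have int_h: "integrable sphere_unif h"
    using B by (intro integrable_sphere_unif[where B=B] h) auto
  have B2: "\<bar>h x * h y\<bar> \<le> B * B" if "norm x = 1" "norm y = 1" for x y
    unfolding abs_mult using B[OF that(1)] B[OF that(2)]
    by (intro mult_mono) auto
  have int_h2: "integrable sphere_unif (\<lambda>x. h x * h x)"
    using h B2 by (intro integrable_sphere_unif[where B="B * B"]) (simp_all only: borel_measurable_times real_norm_def)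
  have int: "integrable (P_null n) (\<lambda>\<omega>. h (\<omega> i) * h (\<omega> j))" if "i \<in> {1..n}" "j \<in> {1..n}" for i j
    using that h
    by (intro P.integrable_const_bound[where B="B * B"] borel_measurable_times measurable_P_null_component)
      (auto intro!: B2 space_P_null_norm AE_I2)
  have prod: "(\<integral>\<omega>. h (\<omega> i) * h (\<omega> j) \<partial>P_null n) = (if i = j then \<integral>x. h x * h x \<partial>sphere_unif else 0)"
    if ij: "i \<in> {1..n}" "j \<in> {1..n}" for i j
  proof -
    \<comment> \<open>Writes \<open>h (\<omega> i) * h (\<omega> j)\<close> as a product over all
      coordinates. For \<open>i = j\<close> a single factor carries both copies of \<open>h\<close>,
      so one Fubini argument covers the diagonal and the off-diagonal case.\<close>
    define F where "F k x = (if k = i then h x else 1) * (if k = j then h x else 1)" for k x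
    have F: "integrable sphere_unif (F k)" for k
      unfolding F_def using int_h int_h2 by (cases "k = i"; cases "k = j") simp_all
    have "(\<integral>\<omega>. h (\<omega> i) * h (\<omega> j) \<partial>P_null n) = (\<integral>\<omega>. (\<Prod>k\<in>{1..n}. F k (\<omega> k)) \<partial>P_null n)"
      using ij by (simp add: F_def prod.distrib)
    also have "\<dots> = (\<Prod>k\<in>{1..n}. integral\<^sup>L sphere_unif (F k))"
      unfolding P_null_def by (rule US.product_integral_prod) (auto intro: F)
    also have "\<dots> = (if i = j then \<integral>x. h x * h x \<partial>sphere_unif else 0)"
    proof (cases "i = j")
      case True
      have "integral\<^sup>L sphere_unif (F k) = (if k = i then \<integral>x. h x * h x \<partial>sphere_unif else 1)" for k
        using True U.prob_space[where 'a='a] by (simp add: F_def[abs_def])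
      then show ?thesis using True ij by simp
    next
      case False
      then have "integral\<^sup>L sphere_unif (F i) = 0"
        using mean by (simp add: F_def[abs_def])
      then have "(\<Prod>k\<in>{1..n}. integral\<^sup>L sphere_unif (F k)) = 0"
        using ij by (intro prod_zero) auto
      then show ?thesis using False by simp
    qed
    finally show ?thesis .
  qed
  have sq: "(\<Sum>i\<in>{1..n}. h (\<omega> i))\<^sup>2 = (\<Sum>i\<in>{1..n}. \<Sum>j\<in>{1..n}. h (\<omega> i) * h (\<omega> j))" for \<omega> :: "nat \<Rightarrow> 'a"
    by (simp add: power2_eq_square sum_product)
  show "integrable (P_null n) (\<lambda>\<omega>. (\<Sum>i\<in>{1..n}. h (\<omega> i))\<^sup>2)"
    unfolding sq by (intro Bochner_Integration.integrable_sum int)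
  have "(\<integral>\<omega>. (\<Sum>i\<in>{1..n}. h (\<omega> i))\<^sup>2 \<partial>P_null n)
      = (\<Sum>i\<in>{1..n}. \<integral>\<omega>. (\<Sum>j\<in>{1..n}. h (\<omega> i) * h (\<omega> j)) \<partial>P_null n)"
    unfolding sq by (intro Bochner_Integration.integral_sum Bochner_Integration.integrable_sum int)
  also have "\<dots> = (\<Sum>i\<in>{1..n}. \<Sum>j\<in>{1..n}. \<integral>\<omega>. h (\<omega> i) * h (\<omega> j) \<partial>P_null n)"
    by (intro sum.cong refl Bochner_Integration.integral_sum int)
  also have "\<dots> = (\<Sum>i\<in>{1..n}. \<Sum>j\<in>{1..n}. if i = j then \<integral>x. h x * h x \<partial>sphere_unif else 0)"
    by (intro sum.cong refl prod)
  also have "\<dots> = real n * (\<integral>x. (h x)\<^sup>2 \<partial>sphere_unif)"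
    by (simp add: power2_eq_square)
  finally show "(\<integral>\<omega>. (\<Sum>i\<in>{1..n}. h (\<omega> i))\<^sup>2 \<partial>P_null n) = real n * (\<integral>x. (h x)\<^sup>2 \<partial>sphere_unif)" .
qed

lemma P_null_sum_tail:
  fixes h :: "'a::euclidean_space \<Rightarrow> real"
  assumes h: "h \<in> borel_measurable borel" and B: "\<And>x. norm x = 1 \<Longrightarrow> \<bar>h x\<bar> \<le> B"
    and mean: "(\<integral>x. h x \<partial>sphere_unif) = 0" and a: "a > 0"
  shows "measure (P_null n) {\<omega> \<in> space (P_null n). \<bar>\<Sum>i\<in>{1..n}. h (\<omega> i)\<bar> \<ge> a}
    \<le> real n * (\<integral>x. (h x)\<^sup>2 \<partial>sphere_unif) / a\<^sup>2"
  using P.second_moment_method[of "\<lambda>\<omega>. \<Sum>i\<in>{1..n}. h (\<omega> i)" n a]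
    integrable_P_null_sum_power2[OF h B mean] integral_P_null_sum_power2[OF h B mean, of n] a
    borel_measurable_sum[of "{1..n}" "\<lambda>i \<omega>. h (\<omega> i)" "P_null n"] measurable_P_null_component[OF _ h]
  by simp

section \<open>Densities of product laws and the exact likelihood ratio\<close>

lemma PiM_density:
  assumes "product_sigma_finite M" "product_sigma_finite (\<lambda>i. density (M i) (g i))" and I: "finite I"
    and g: "\<And>i. i \<in> I \<Longrightarrow> g i \<in> borel_measurable (M i)"
  shows "PiM I (\<lambda>i. density (M i) (g i)) = density (PiM I M) (\<lambda>\<omega>. \<Prod>i\<in>I. g i (\<omega> i))"
proof -
  interpret M: product_sigma_finite M by fact
  interpret D: product_sigma_finite "\<lambda>i. density (M i) (g i)" by fact
  have meas: "(\<lambda>\<omega>. \<Prod>i\<in>I. g i (\<omega> i)) \<in> borel_measurable (PiM I M)"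
    using g by (intro borel_measurable_prod_ennreal measurable_PiM_component_rev)
  show ?thesis
  proof (rule D.PiM_eqI[symmetric, OF I])
    show "sets (density (PiM I M) (\<lambda>\<omega>. \<Prod>i\<in>I. g i (\<omega> i))) = sets (PiM I (\<lambda>i. density (M i) (g i)))"
      unfolding sets_density by (rule sets_PiM_cong) simp_all
    fix A assume "\<And>i. i \<in> I \<Longrightarrow> A i \<in> sets (density (M i) (g i))"
    then have A: "\<And>i. i \<in> I \<Longrightarrow> A i \<in> sets (M i)" by simp
    \<comment> \<open>Rectangles determine a product measure, and on a rectangle the integrand
      factors over the coordinates.\<close>
    have "emeasure (density (PiM I M) (\<lambda>\<omega>. \<Prod>i\<in>I. g i (\<omega> i))) (Pi\<^sub>E I A)
        = (\<integral>\<^sup>+\<omega>. (\<Prod>i\<in>I. g i (\<omega> i)) * indicator (Pi\<^sub>E I A) \<omega> \<partial>PiM I M)"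
      using A I meas by (intro emeasure_density sets_PiM_I_finite) auto
    also have "\<dots> = (\<integral>\<^sup>+\<omega>. (\<Prod>i\<in>I. g i (\<omega> i) * indicator (A i) (\<omega> i)) \<partial>PiM I M)"
    proof (rule nn_integral_cong)
      fix \<omega> assume "\<omega> \<in> space (PiM I M)"
      \<comment> \<open>Membership in \<open>Pi\<^sub>E I A\<close> also fixes the values outside
        \<open>I\<close>; points of the product space satisfy this automatically, so the indicator
        is the product of the coordinate indicators.\<close>
      then have "\<omega> \<in> extensional I" by (auto simp: space_PiM PiE_def)
      then have "indicator (Pi\<^sub>E I A) \<omega> = (\<Prod>i\<in>I. indicator (A i) (\<omega> i) :: ennreal)"
      proof (cases "\<forall>i\<in>I. \<omega> i \<in> A i")
        case False
        then obtain i where "i \<in> I" "\<omega> i \<notin> A i" by blast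
        then have "(\<Prod>i\<in>I. indicator (A i) (\<omega> i) :: ennreal) = 0"
          by (intro prod_zero[OF I] bexI[of _ i]) auto
        then show ?thesis using False by (auto simp: PiE_iff)
      qed (simp add: PiE_iff)
      then show "(\<Prod>i\<in>I. g i (\<omega> i)) * indicator (Pi\<^sub>E I A) \<omega> = (\<Prod>i\<in>I. g i (\<omega> i) * indicator (A i) (\<omega> i))"
        by (simp add: prod.distrib)
    qed
    also have "\<dots> = (\<Prod>i\<in>I. \<integral>\<^sup>+x. g i x * indicator (A i) x \<partial>M i)"
      using A g I by (intro M.product_nn_integral_prod) auto
    also have "\<dots> = (\<Prod>i\<in>I. emeasure (density (M i) (g i)) (A i))"
      using A g by (intro prod.cong refl) (simp add: emeasure_density)
    finally show "emeasure (density (PiM I M) (\<lambda>\<omega>. \<Prod>i\<in>I. g i (\<omega> i))) (Pi\<^sub>E I A)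
        = (\<Prod>i\<in>I. emeasure (density (M i) (g i)) (A i))" .
  qed
qed

text \<open>Links the two reference measures: \<open>rot_law\<close> has a density with respect to
  \<open>sphere_measure\<close>, whereas the likelihood ratio is taken against the uniform
  law.\<close>

lemma sphere_unif_eq_density:
  "(sphere_unif :: 'a::euclidean_space measure) =
    density sphere_measure (\<lambda>_. ennreal (1 / measure sphere_measure (sphere 0 1 :: 'a set)))"
  and measure_sphere_pos: "measure sphere_measure (sphere 0 1 :: 'a set) > 0"
proof -
  let ?S = "sphere 0 1 :: 'a set"
  have pos: "0 < real DIM('a) * measure lborel (cball 0 1 :: 'a set)"
    by (simp add: content_cball_pos)
  then have c: "measure sphere_measure ?S = real DIM('a) * measure lborel (cball 0 1 :: 'a set)"
    by (simp add: measure_def emeasure_sphere_measure_space)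
  with pos show pos': "measure sphere_measure ?S > 0" by simp
  have S: "?S \<in> sets sphere_measure"
    using sets.top[of "sphere_measure :: 'a measure"] by (simp only: space_sphere_measure)
  have "emeasure sphere_measure ?S = ennreal (measure sphere_measure ?S)"
    unfolding c by (rule emeasure_sphere_measure_space)
  then have eq: "indicator ?S x / emeasure sphere_measure ?S = ennreal (1 / measure sphere_measure ?S)" if "x \<in> ?S" for x
    using that pos' divide_ennreal[of 1 "measure sphere_measure ?S"] by simp
  show "(sphere_unif :: 'a measure) = density sphere_measure (\<lambda>_. ennreal (1 / measure sphere_measure ?S))"
    unfolding sphere_unif_def uniform_measure_def
  proof (rule density_cong)
    show "(\<lambda>x. indicator ?S x / emeasure sphere_measure ?S) \<in> borel_measurable sphere_measure"
      using S by (intro borel_measurable_divide_ennreal borel_measurable_indicator borel_measurable_const)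
    show "AE x::'a in sphere_measure. indicator ?S x / emeasure sphere_measure ?S = ennreal (1 / measure sphere_measure ?S)"
      by (rule AE_I2) (simp only: space_sphere_measure eq)
  qed simp
qed

context
  fixes f :: "real \<Rightarrow> real"
  assumes f_pos: "\<And>x. f x > 0" and f_mono: "strict_mono f" and f_0: "f 0 = 1"
begin

lemma f_borel: "f \<in> borel_measurable borel"
  using f_mono by (intro borel_measurable_mono strict_mono_mono)

lemma f_inner_borel: "(\<lambda>x. f (u \<bullet> x)) \<in> borel_measurable borel" for u :: "'a::euclidean_space"
  by (rule measurable_compose[OF _ f_borel]) measurable

text \<open>Monotonicity turns the Cauchy-Schwarz bound into positive constants on both sides; the
  upper one gives integrability, the lower one positivity of the normalising constant.\<close>

lemma f_inner_bounds:
  fixes u x :: "'a::euclidean_space"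
  assumes "norm x = 1"
  shows "f (- norm u) \<le> f (u \<bullet> x)" "f (u \<bullet> x) \<le> f (norm u)"
  using abs_inner_sphere_le[OF assms, of u]
    monoD[OF strict_mono_mono[OF f_mono], of "- norm u" "u \<bullet> x"]
    monoD[OF strict_mono_mono[OF f_mono], of "u \<bullet> x" "norm u"]
  by linarith+

lemma integrable_f_inner: "integrable sphere_unif (\<lambda>x. f (u \<bullet> x))" for u :: "'a::euclidean_space"
  using f_inner_bounds(2)[of _ u] less_imp_le[OF f_pos]
  by (intro integrable_sphere_unif[where B="f (norm u)"] f_inner_borel) auto

lemma integral_f_inner_pos: "(\<integral>x. f (u \<bullet> x) \<partial>sphere_unif) > 0" for u :: "'a::euclidean_space"
proof -
  have "f (- norm u) \<le> (\<integral>x. f (u \<bullet> x) \<partial>sphere_unif)"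
    using integral_sphere_unif_mono[OF _ integrable_f_inner f_inner_bounds(1), of u]
      U.prob_space[where 'a='a] by simp
  then show ?thesis using f_pos by (rule less_le_trans[rotated])
qed

text \<open>The total surface mass enters both the uniform density and the normalising integral, and
  cancels. The vector \<open>u\<close> recombines direction and concentration.\<close>

lemma rot_law_eq_density_sphere_unif:
  fixes u :: "'a::euclidean_space"
  assumes "u \<noteq> 0"
  shows "rot_law (u /\<^sub>R norm u) (norm u) f =
    density sphere_unif (\<lambda>x. ennreal (f (u \<bullet> x) / (\<integral>y. f (u \<bullet> y) \<partial>sphere_unif)))"
proof -
  define c where "c = measure sphere_measure (sphere 0 1 :: 'a set)"
  have c: "c > 0" unfolding c_def by (rule measure_sphere_pos)
  have meas: "(\<lambda>x. f (u \<bullet> x)) \<in> borel_measurable sphere_measure"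
    using measurable_restrict_space1[OF f_inner_borel[of u], of "sphere 0 1"]
    by (simp cong: measurable_cong_sets)
  have eq: "norm u * (x \<bullet> (u /\<^sub>R norm u)) = u \<bullet> x" for x
    using assms by (simp add: inner_commute)
  have I: "(\<integral>y. f (u \<bullet> y) \<partial>sphere_unif) = (\<integral>y. f (u \<bullet> y) \<partial>sphere_measure) / c"
    using c meas unfolding sphere_unif_eq_density c_def[symmetric]
    by (subst integral_density) auto
  have "density sphere_unif (\<lambda>x. ennreal (f (u \<bullet> x) / (\<integral>y. f (u \<bullet> y) \<partial>sphere_unif)))
     = density sphere_measure (\<lambda>x. ennreal (1 / c) * ennreal (f (u \<bullet> x) / (\<integral>y. f (u \<bullet> y) \<partial>sphere_unif)))"
    using meas unfolding sphere_unif_eq_density c_def[symmetric]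
    by (subst density_density_eq) auto
  also have "\<dots> = density sphere_measure (\<lambda>x. ennreal (f (u \<bullet> x) / (\<integral>y. f (u \<bullet> y) \<partial>sphere_measure)))"
  proof (rule density_cong)
    have "1 / c * (t / (\<integral>y. f (u \<bullet> y) \<partial>sphere_unif)) = t / (\<integral>y. f (u \<bullet> y) \<partial>sphere_measure)" for t
      unfolding I using c by simp
    then show "AE x in sphere_measure. ennreal (1 / c) * ennreal (f (u \<bullet> x) / (\<integral>y. f (u \<bullet> y) \<partial>sphere_unif))
        = ennreal (f (u \<bullet> x) / (\<integral>y. f (u \<bullet> y) \<partial>sphere_measure))"
      using c by (intro AE_I2) (simp only: ennreal_mult'[symmetric] divide_nonneg_pos zero_le_one)
  qed (use meas in auto)
  finally show ?thesis
    unfolding rot_law_def eq by simp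
qed

lemma prob_space_density_f:
  fixes u :: "'a::euclidean_space"
  shows "prob_space (density sphere_unif (\<lambda>x. ennreal (f (u \<bullet> x) / (\<integral>y. f (u \<bullet> y) \<partial>sphere_unif))))"
proof (rule prob_spaceI)
  let ?I = "\<integral>y. f (u \<bullet> y) \<partial>sphere_unif"
  have I: "?I > 0" by (rule integral_f_inner_pos)
  let ?g = "\<lambda>x. ennreal (f (u \<bullet> x) / ?I)"
  have "emeasure (density sphere_unif ?g) (space (density sphere_unif ?g))
      = (\<integral>\<^sup>+x. ?g x * indicator (space sphere_unif) x \<partial>sphere_unif)"
    unfolding space_density using borel_measurable_integrable[OF integrable_f_inner[of u]]
    by (intro emeasure_density sets.top) simp
  also have "\<dots> = (\<integral>\<^sup>+x. ?g x \<partial>sphere_unif)"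
    by (intro nn_integral_cong) simp
  also have "\<dots> = ennreal (\<integral>x. f (u \<bullet> x) / ?I \<partial>sphere_unif)"
    using I f_pos integrable_f_inner[of u]
    by (intro nn_integral_eq_integral) (auto intro!: AE_I2 divide_nonneg_pos less_imp_le)
  also have "\<dots> = 1"
    using I by simp
  finally show "emeasure (density sphere_unif ?g) (space (density sphere_unif ?g)) = 1" .
qed

text \<open>Includes \<open>u = 0\<close>, since \<open>\<tau> n\<close> may vanish for some n:
  there \<open>f 0 = 1\<close> makes every factor 1, in agreement with the convention in
  \<open>P_loc\<close>.\<close>

lemma P_loc_eq_density:
  fixes u :: "'a::euclidean_space"
  shows "P_loc n u f = density (P_null n)
    (\<lambda>\<omega>. \<Prod>i\<in>{1..n}. ennreal (f (u \<bullet> \<omega> i) / (\<integral>y. f (u \<bullet> y) \<partial>sphere_unif)))"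
proof (cases "u = 0")
  case True
  then show ?thesis
    using f_0 U.prob_space[where 'a='a] by (simp add: P_loc_def density_1)
next
  case False
  interpret D: prob_space "density sphere_unif (\<lambda>x. ennreal (f (u \<bullet> x) / (\<integral>y. f (u \<bullet> y) \<partial>sphere_unif)))"
    by (rule prob_space_density_f)
  have D: "product_sigma_finite (\<lambda>_::nat. density sphere_unif (\<lambda>x. ennreal (f (u \<bullet> x) / (\<integral>y. f (u \<bullet> y) \<partial>sphere_unif))))"
    by (simp add: product_sigma_finite_def D.sigma_finite_measure_axioms)
  show ?thesis
    unfolding P_loc_def P_rot_def P_null_def rot_law_eq_density_sphere_unif[OF False]
    using False borel_measurable_integrable[OF integrable_f_inner[of u]]
    by (subst PiM_density[OF US.product_sigma_finite_axioms D]) simp_all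
qed

text \<open>Holds only almost everywhere because \<open>RN_deriv\<close> is determined only up to
  null sets. The product density is finite and positive, so neither \<open>enn2real\<close> nor
  \<open>ln\<close> falls back on a default value.\<close>

lemma log_likelihood_ratio_P_loc:
  fixes u :: "'a::euclidean_space"
  shows "AE \<omega> in P_null n. log_likelihood_ratio (P_loc n u f) (P_null n) \<omega> =
    (\<Sum>i\<in>{1..n}. ln (f (u \<bullet> \<omega> i))) - real n * ln (\<integral>y. f (u \<bullet> y) \<partial>sphere_unif)"
proof -
  let ?I = "\<integral>y. f (u \<bullet> y) \<partial>sphere_unif"
  have I: "?I > 0" by (rule integral_f_inner_pos)
  have nz: "f t \<noteq> 0" for t using f_pos[of t] by linarith
  have "(\<lambda>\<omega>. \<Prod>i\<in>{1..n}. ennreal (f (u \<bullet> \<omega> i) / ?I)) \<in> borel_measurable (P_null n)"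
    using f_inner_borel[of u] by (intro borel_measurable_prod_ennreal measurable_P_null_component) auto
  from P.RN_deriv_unique[OF this P_loc_eq_density[symmetric]] show ?thesis
  proof eventually_elim
    case (elim \<omega>)
    have "(\<Prod>i\<in>{1..n}. ennreal (f (u \<bullet> \<omega> i) / ?I)) = ennreal (\<Prod>i\<in>{1..n}. f (u \<bullet> \<omega> i) / ?I)"
      using I f_pos by (intro prod_ennreal) (auto intro: less_imp_le)
    moreover have "(\<Prod>i\<in>{1..n}. f (u \<bullet> \<omega> i) / ?I) > 0"
      using I f_pos by (intro prod_pos) auto
    ultimately have "log_likelihood_ratio (P_loc n u f) (P_null n) \<omega> = ln (\<Prod>i\<in>{1..n}. f (u \<bullet> \<omega> i) / ?I)"
      unfolding log_likelihood_ratio_def elim[symmetric] by simp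
    also have "\<dots> = (\<Sum>i\<in>{1..n}. ln (f (u \<bullet> \<omega> i) / ?I))"
      using I nz by (intro ln_prod) simp_all
    also have "\<dots> = (\<Sum>i\<in>{1..n}. ln (f (u \<bullet> \<omega> i)) - ln ?I)"
      by (intro sum.cong refl ln_divide_pos f_pos I)
    finally show ?case
      by (simp add: sum_subtractf)
  qed
qed

end

section \<open>Local expansion of the log-likelihood ratio\<close>

text \<open>As \<open>F'\<close> is differentiable only at 0, the mean value inequality is applied
  to \<open>F\<close> minus its quadratic part: the derivative \<open>F' s - F' 0 - a * s\<close> is
  at most \<open>\<eta> * \<bar>s\<bar>\<close>, hence at most \<open>\<eta> * \<bar>t\<bar>\<close>
  on the ball of radius \<open>\<bar>t\<bar>\<close>.\<close>

lemma Taylor_Peano_2: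
  fixes F F' :: "real \<Rightarrow> real"
  assumes F: "eventually (\<lambda>x. (F has_real_derivative F' x) (at x)) (nhds 0)"
    and F': "(F' has_real_derivative a) (at 0)" and \<eta>: "\<eta> > 0"
  shows "eventually (\<lambda>t. \<bar>F t - F 0 - F' 0 * t - a / 2 * t\<^sup>2\<bar> \<le> \<eta> * t\<^sup>2) (nhds 0)"
proof -
  obtain d1 where d1: "d1 > 0" "\<And>x. \<bar>x\<bar> < d1 \<Longrightarrow> (F has_real_derivative F' x) (at x)"
    using F unfolding eventually_nhds_metric by (auto simp: dist_real_def)
  obtain d2 where d2: "d2 > 0" "\<And>x. \<bar>x\<bar> < d2 \<Longrightarrow> \<bar>F' x - F' 0 - a * x\<bar> \<le> \<eta> * \<bar>x\<bar>"
    using F' \<eta> unfolding has_field_derivative_def has_derivative_at_alt by (auto simp: mult.commute)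
  have "\<bar>F t - F 0 - F' 0 * t - a / 2 * t\<^sup>2\<bar> \<le> \<eta> * t\<^sup>2" if t: "\<bar>t\<bar> < min d1 d2" for t
  proof -
    define G where "G s = F s - F' 0 * s - a / 2 * s\<^sup>2" for s
    have "norm (G t - G 0) \<le> (\<eta> * \<bar>t\<bar>) * norm (t - 0)"
    proof (rule field_differentiable_bound)
      show "convex (cball (0::real) \<bar>t\<bar>)" "t \<in> cball 0 \<bar>t\<bar>" "0 \<in> cball (0::real) \<bar>t\<bar>"
        by auto
      fix s :: real assume s: "s \<in> cball 0 \<bar>t\<bar>"
      then have s': "\<bar>s\<bar> < d1" "\<bar>s\<bar> < d2" "\<bar>s\<bar> \<le> \<bar>t\<bar>" using t by auto
      show "(G has_field_derivative (F' s - F' 0 - a * s)) (at s within cball 0 \<bar>t\<bar>)"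
        unfolding G_def
        by (rule has_field_derivative_at_within) (auto intro!: derivative_eq_intros d1(2) s')
      show "norm (F' s - F' 0 - a * s) \<le> \<eta> * \<bar>t\<bar>"
        using d2(2)[OF s'(2)] mult_left_mono[OF s'(3) less_imp_le[OF \<eta>]]
        unfolding real_norm_def by linarith
    qed
    then show ?thesis
      by (simp add: G_def power2_eq_square abs_mult_self_eq mult.assoc algebra_simps)
  qed
  then show ?thesis
    unfolding eventually_nhds_metric using d1(1) d2(1)
    by (intro exI[of _ "min d1 d2"]) (auto simp: dist_real_def)
qed

lemma measurable_Delta: "(Delta n :: (nat \<Rightarrow> 'a::euclidean_space) \<Rightarrow> 'a) \<in> P_null n \<rightarrow>\<^sub>M borel"
proof -
  have [measurable]: "(\<lambda>\<omega>. \<omega> i :: 'a) \<in> P_null n \<rightarrow>\<^sub>M borel" if "i \<in> {1..n}" for i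
    using measurable_P_null_component[OF that, of "\<lambda>x::'a. x" borel] by simp
  have "(\<lambda>\<omega>. \<Sum>i\<in>{1..n}. \<omega> i :: 'a) \<in> P_null n \<rightarrow>\<^sub>M borel"
    by measurable
  then show ?thesis
    unfolding Delta_def[abs_def] sample_mean_def by measurable
qed

lemma borel_measurable_log_likelihood_ratio:
  "log_likelihood_ratio M N \<in> borel_measurable N"
  unfolding log_likelihood_ratio_def[abs_def]
  using borel_measurable_RN_deriv[of N M] by measurable

lemma eventually_nhds_0_abs_leD:
  assumes "eventually Q (nhds (0::real))"
  obtains d where "d > 0" "\<And>t. \<bar>t\<bar> \<le> d \<Longrightarrow> Q t"
proof -
  obtain e where "e > 0" "\<And>t. \<bar>t\<bar> < e \<Longrightarrow> Q t"
    using assms unfolding eventually_nhds_metric by (auto simp: dist_real_def)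
  then show ?thesis using that[of "e / 2"] by force
qed

text \<open>The pointwise expansion can be integrated because
  \<open>\<bar>u \<bullet> x\<bar>\<close> never exceeds \<open>norm u\<close>. The linear term has
  mean zero, and the quadratic term and the remainder both integrate to multiples of
  \<open>(norm u)\<^sup>2 / DIM('a)\<close>.\<close>

lemma integral_sphere_unif_Taylor:
  fixes u :: "'a::euclidean_space" and f :: "real \<Rightarrow> real"
  assumes int: "integrable sphere_unif (\<lambda>x. f (u \<bullet> x))"
    and f: "\<And>t. \<bar>t\<bar> \<le> norm u \<Longrightarrow> \<bar>f t - 1 - t - a / 2 * t\<^sup>2\<bar> \<le> \<eta> * t\<^sup>2"
  shows "\<bar>(\<integral>x. f (u \<bullet> x) \<partial>sphere_unif) - 1 - a / 2 * (norm u)\<^sup>2 / DIM('a)\<bar> \<le> \<eta> * (norm u)\<^sup>2 / DIM('a)"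
proof -
  have i1: "integrable sphere_unif (\<lambda>x. u \<bullet> x)"
    using abs_inner_sphere_le[of _ u] by (intro integrable_sphere_unif[where B="norm u"]) auto
  have i2: "integrable sphere_unif (\<lambda>x. (u \<bullet> x)\<^sup>2)"
    using abs_inner_sphere_le[of _ u]
    by (intro integrable_sphere_unif[where B="(norm u)\<^sup>2"]) (auto simp: abs_le_square_iff[symmetric])
  have "\<bar>\<integral>x. f (u \<bullet> x) - 1 - u \<bullet> x - a / 2 * (u \<bullet> x)\<^sup>2 \<partial>sphere_unif\<bar>
      \<le> (\<integral>x. \<bar>f (u \<bullet> x) - 1 - u \<bullet> x - a / 2 * (u \<bullet> x)\<^sup>2\<bar> \<partial>sphere_unif)"
    by (rule integral_abs_bound)
  also have "\<dots> \<le> (\<integral>x. \<eta> * (u \<bullet> x)\<^sup>2 \<partial>sphere_unif)"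
    using int i1 i2 f abs_inner_sphere_le[of _ u] by (intro integral_sphere_unif_mono) auto
  also have "\<dots> = \<eta> * (norm u)\<^sup>2 / DIM('a)"
    by (simp add: integral_sphere_unif_inner_power2)
  also have "(\<integral>x. f (u \<bullet> x) - 1 - u \<bullet> x - a / 2 * (u \<bullet> x)\<^sup>2 \<partial>sphere_unif)
      = (\<integral>x. f (u \<bullet> x) \<partial>sphere_unif) - 1 - a / 2 * (norm u)\<^sup>2 / DIM('a)"
    using int i1 i2 U.prob_space[where 'a='a]
    by (simp add: integral_sphere_unif_inner integral_sphere_unif_inner_power2)
  finally show ?thesis .
qed

text \<open>The hypotheses force \<open>q n\<close> to be O(1/n), so replacing
  \<open>ln (1 + q n)\<close> by \<open>q n\<close> costs n times O(1/n^2).\<close>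

lemma tendsto_n_ln_1_plus:
  fixes q s :: "nat \<Rightarrow> real"
  assumes q: "(\<lambda>n. real n * q n - s n) \<longlonglongrightarrow> 0" and s: "eventually (\<lambda>n. \<bar>s n\<bar> \<le> B) sequentially"
  shows "(\<lambda>n. real n * ln (1 + q n) - s n) \<longlonglongrightarrow> 0"
proof -
  have q_bd: "eventually (\<lambda>n. \<bar>q n\<bar> \<le> (B + 1) / real n) sequentially"
    using tendstoD[OF q zero_less_one] s eventually_gt_at_top[of 0]
    by eventually_elim (auto simp: dist_real_def field_simps abs_if split: if_splits)
  have lim: "(\<lambda>n. (B + 1) / real n) \<longlonglongrightarrow> 0"
    by (intro tendsto_divide_0[OF tendsto_const] filterlim_at_top_imp_at_infinity filterlim_real_sequentially)
  \<comment> \<open>The quadratic bound on \<open>ln (1 + x) - x\<close> is applied for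
    \<open>\<bar>x\<bar> \<le> 1 / 2\<close>.\<close>
  have lim2: "eventually (\<lambda>n. (B + 1) / real n < 1 / 2) sequentially"
    by (rule order_tendstoD(2)[OF lim]) simp
  have bd: "eventually (\<lambda>n. norm (real n * (ln (1 + q n) - q n)) \<le> 2 * (B + 1) * ((B + 1) / real n)) sequentially"
    using q_bd lim2 eventually_gt_at_top[of 0]
  proof eventually_elim
    case (elim n)
    then have "\<bar>ln (1 + q n) - q n\<bar> \<le> 2 * (q n)\<^sup>2"
      by (intro abs_ln_one_plus_x_minus_x_bound) linarith
    also have "\<dots> \<le> 2 * ((B + 1) / real n)\<^sup>2"
      using power_mono[OF elim(1), of 2] by simp
    finally have "real n * \<bar>ln (1 + q n) - q n\<bar> \<le> real n * (2 * ((B + 1) / real n)\<^sup>2)"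
      by (rule mult_left_mono) simp
    also have "\<dots> = 2 * (B + 1) * ((B + 1) / real n)"
      using elim(3) by (simp add: power2_eq_square field_simps)
    finally show ?case by (simp add: abs_mult)
  qed
  have "(\<lambda>n. 2 * (B + 1) * ((B + 1) / real n)) \<longlonglongrightarrow> 2 * (B + 1) * 0"
    by (intro tendsto_intros lim)
  then have "(\<lambda>n. real n * (ln (1 + q n) - q n)) \<longlonglongrightarrow> 0"
    by (intro Lim_null_comparison[OF bd]) simp
  from tendsto_add[OF this q] show ?thesis
    by (simp add: algebra_simps)
qed

text \<open>The error splits as \<open>R + (a - 1) / 2 * ?V - ?D\<close>: the summed Taylor
  remainders of \<open>ln f\<close>, the centred sum of squares, and the error in the logarithm of
  the normalising constant. \<open>R\<close> and \<open>?D\<close> have non-random bounds, so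
  Chebyshev is applied to \<open>?V\<close> alone.\<close>

lemma log_likelihood_ratio_expansion:
  fixes \<tau> \<mu> :: "nat \<Rightarrow> 'a::euclidean_space" and f :: "real \<Rightarrow> real"
  assumes mu: "\<And>n. n \<ge> 1 \<Longrightarrow> \<mu> n = sqrt (real DIM('a) / real n) *\<^sub>R \<tau> n"
    and tau: "eventually (\<lambda>n. norm (\<tau> n) \<le> C) sequentially"
    and f_pos: "\<And>x. f x > 0" and f_mono: "strict_mono f" and f_0: "f 0 = 1"
    and f': "eventually (\<lambda>x. (f has_real_derivative f' x) (at x)) (nhds 0)" and f'_0: "f' 0 = 1"
    and f'': "(f' has_real_derivative a) (at 0)"
  shows "small_oP1 P_null
    (\<lambda>n \<omega>. log_likelihood_ratio (P_loc n (\<mu> n) f) (P_null n) \<omega>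
      - (\<tau> n \<bullet> Delta n \<omega> - 1 / 2 * (norm (\<tau> n))\<^sup>2))"
proof -
  let ?p = "real DIM('a)"
  let ?E = "\<lambda>n. \<integral>x. f (\<mu> n \<bullet> x) \<partial>sphere_unif"
  let ?Z = "\<lambda>n \<omega>. log_likelihood_ratio (P_loc n (\<mu> n) f) (P_null n) \<omega>
      - (\<tau> n \<bullet> Delta n \<omega> - 1 / 2 * (norm (\<tau> n))\<^sup>2)"
  have p: "?p > 0" by simp
  have norm_mu: "real n * (norm (\<mu> n))\<^sup>2 = ?p * (norm (\<tau> n))\<^sup>2" if "n \<ge> 1" for n
    using that by (simp add: mu power_mult_distrib)
  have tau2: "eventually (\<lambda>n. (norm (\<tau> n))\<^sup>2 \<le> C\<^sup>2) sequentially"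
    using tau by eventually_elim (simp add: power_mono)
  have "eventually (\<lambda>n. norm (\<mu> n) \<le> sqrt (?p / real n) * C) sequentially"
    using tau eventually_ge_at_top[of 1] by eventually_elim (simp add: mu mult_left_mono)
  moreover have "(\<lambda>n. sqrt (?p / real n) * C) \<longlonglongrightarrow> sqrt 0 * C"
    by (intro tendsto_intros tendsto_divide_0[OF tendsto_const] filterlim_at_top_imp_at_infinity filterlim_real_sequentially)
  ultimately have mu_0: "(\<lambda>n. norm (\<mu> n)) \<longlonglongrightarrow> 0"
    by (intro Lim_null_comparison[of "\<lambda>n. norm (\<mu> n)" "\<lambda>n. sqrt (?p / real n) * C"]) auto
  have mu_small: "eventually (\<lambda>n. norm (\<mu> n) \<le> d) sequentially" if "d > 0" for d
    using order_tendstoD(2)[OF mu_0 that] by (auto elim: eventually_mono)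

  have D: "(\<lambda>n. real n * ln (?E n) - a / 2 * (norm (\<tau> n))\<^sup>2) \<longlonglongrightarrow> 0"
  proof -
    have "(\<lambda>n. real n * (?E n - 1) - a / 2 * (norm (\<tau> n))\<^sup>2) \<longlonglongrightarrow> 0"
    proof (rule tendstoI)
      fix \<epsilon> :: real assume \<epsilon>: "\<epsilon> > 0"
      \<comment> \<open>Makes \<open>\<eta> * (norm (\<tau> n))\<^sup>2\<close> at most
        \<open>\<epsilon> / 2\<close>; the summand 1 keeps the denominator positive when
        \<open>C = 0\<close>.\<close>
      define \<eta> where "\<eta> = \<epsilon> / (2 * (C\<^sup>2 + 1))"
      have \<eta>: "\<eta> > 0" using \<epsilon> unfolding \<eta>_def
        by (intro divide_pos_pos mult_pos_pos) (auto intro: add_nonneg_pos)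
      obtain d where d: "d > 0" "\<And>t. \<bar>t\<bar> \<le> d \<Longrightarrow> \<bar>f t - 1 - t - a / 2 * t\<^sup>2\<bar> \<le> \<eta> * t\<^sup>2"
        using Taylor_Peano_2[OF f' f'' \<eta>] by (rule eventually_nhds_0_abs_leD) (auto simp: f_0 f'_0)
      show "eventually (\<lambda>n. dist (real n * (?E n - 1) - a / 2 * (norm (\<tau> n))\<^sup>2) 0 < \<epsilon>) sequentially"
        using mu_small[OF d(1)] tau2 eventually_ge_at_top[of 1]
      proof eventually_elim
        case (elim n)
        have "\<bar>?E n - 1 - a / 2 * (norm (\<mu> n))\<^sup>2 / ?p\<bar> \<le> \<eta> * (norm (\<mu> n))\<^sup>2 / ?p"
          using elim(1) by (intro integral_sphere_unif_Taylor d(2) integrable_f_inner[OF f_pos f_mono f_0]) auto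
        then have "real n * \<bar>?E n - 1 - a / 2 * (norm (\<mu> n))\<^sup>2 / ?p\<bar> \<le> real n * (\<eta> * (norm (\<mu> n))\<^sup>2 / ?p)"
          by (rule mult_left_mono) simp
        moreover have "real n * (\<eta> * (norm (\<mu> n))\<^sup>2 / ?p) = \<eta> * (norm (\<tau> n))\<^sup>2"
        proof -
          have "real n * (\<eta> * (norm (\<mu> n))\<^sup>2 / ?p) = \<eta> * (real n * (norm (\<mu> n))\<^sup>2) / ?p" by simp
          then show ?thesis using p by (simp add: norm_mu[OF elim(3)])
        qed
        moreover have "real n * \<bar>?E n - 1 - a / 2 * (norm (\<mu> n))\<^sup>2 / ?p\<bar> = \<bar>real n * (?E n - 1) - a / 2 * (norm (\<tau> n))\<^sup>2\<bar>"
        proof -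
          have "real n * (?E n - 1 - a / 2 * (norm (\<mu> n))\<^sup>2 / ?p)
             = real n * (?E n - 1) - a / 2 * (real n * (norm (\<mu> n))\<^sup>2) / ?p"
            by (simp add: algebra_simps)
          also have "\<dots> = real n * (?E n - 1) - a / 2 * (norm (\<tau> n))\<^sup>2"
            unfolding norm_mu[OF elim(3)] using p by simp
          finally show ?thesis by (metis abs_mult abs_of_nat)
        qed
        moreover have "\<eta> * (norm (\<tau> n))\<^sup>2 \<le> \<eta> * (C\<^sup>2 + 1)"
          using elim(2) \<eta> by (intro mult_left_mono) auto
        moreover have "\<eta> * (C\<^sup>2 + 1) = \<epsilon> / 2"
          using add_nonneg_pos[of "C\<^sup>2" 1] by (simp add: \<eta>_def field_simps)
        ultimately show ?case using \<epsilon> by (simp add: dist_real_def)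
      qed
    qed
    moreover have "eventually (\<lambda>n. \<bar>a / 2 * (norm (\<tau> n))\<^sup>2\<bar> \<le> \<bar>a / 2\<bar> * C\<^sup>2) sequentially"
      using tau2 by eventually_elim (simp add: abs_mult mult_left_mono)
    ultimately show ?thesis
      using tendsto_n_ln_1_plus[of "\<lambda>n. ?E n - 1" "\<lambda>n. a / 2 * (norm (\<tau> n))\<^sup>2" "\<bar>a / 2\<bar> * C\<^sup>2"] by simp
  qed

  have ln_f': "eventually (\<lambda>x. ((\<lambda>x. ln (f x)) has_real_derivative f' x / f x) (at x)) (nhds 0)"
    using f' by eventually_elim (auto intro!: derivative_eq_intros simp: f_pos)
  have "(f has_real_derivative 1) (at 0)"
    using eventually_nhds_x_imp_x[OF f'] by (simp add: f'_0)
  \<comment> \<open>The quotient rule with \<open>f 0 = f' 0 = 1\<close> gives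
    \<open>a - 1\<close>.\<close>
  then have ln_f'': "((\<lambda>x. f' x / f x) has_real_derivative a - 1) (at 0)"
    using f'' by (auto intro!: derivative_eq_intros simp: f_0 f'_0)

  have meas: "?Z n \<in> borel_measurable (P_null n)" for n
    using borel_measurable_log_likelihood_ratio measurable_Delta[of n] by measurable
  moreover have "(\<lambda>n. measure (P_null n) {\<omega> \<in> space (P_null n). \<bar>?Z n \<omega>\<bar> > \<epsilon>}) \<longlonglongrightarrow> 0" if \<epsilon>: "\<epsilon> > 0" for \<epsilon>
  proof -
    \<comment> \<open>Of a deviation exceeding \<open>\<epsilon>\<close>, \<open>R\<close> and
      \<open>?D\<close> account for at most \<open>\<epsilon> / 4\<close> each, so
      \<open>\<bar>a - 1\<bar> * \<bar>?V\<bar>\<close> exceeds \<open>\<epsilon>\<close>. The added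
      1 covers \<open>a = 1\<close>.\<close>
    define b where "b = \<epsilon> / (\<bar>a - 1\<bar> + 1)"
    have b: "b > 0" using \<epsilon> by (simp add: b_def)
    \<comment> \<open>The n remainders sum to at most
      \<open>\<eta> * (?p * (norm (\<tau> n))\<^sup>2)\<close>, which this choice keeps below
      \<open>\<epsilon> / 4\<close>.\<close>
    define \<eta> where "\<eta> = \<epsilon> / (4 * ?p * (C\<^sup>2 + 1))"
    have \<eta>: "\<eta> > 0" using \<epsilon> p unfolding \<eta>_def
      by (intro divide_pos_pos mult_pos_pos) (auto intro: add_nonneg_pos)
    obtain d where d: "d > 0" "\<And>t. \<bar>t\<bar> \<le> d \<Longrightarrow> \<bar>ln (f t) - t - (a - 1) / 2 * t\<^sup>2\<bar> \<le> \<eta> * t\<^sup>2"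
      using Taylor_Peano_2[OF ln_f' ln_f'' \<eta>] by (rule eventually_nhds_0_abs_leD) (auto simp: f_0 f'_0)
    define h where "h n x = (\<mu> n \<bullet> x)\<^sup>2 - (norm (\<mu> n))\<^sup>2 / ?p" for n and x :: 'a
    have h_meas: "h n \<in> borel_measurable borel" for n
      unfolding h_def by measurable
    have sq_le: "(\<mu> n \<bullet> x)\<^sup>2 \<le> (norm (\<mu> n))\<^sup>2" if "norm x = 1" for n x
      using abs_inner_sphere_le[OF that, of "\<mu> n"] by (simp add: abs_le_square_iff[symmetric])
    have h_bd: "\<bar>h n x\<bar> \<le> (norm (\<mu> n))\<^sup>2" if "norm x = 1" for n x
    proof -
      have "(norm (\<mu> n))\<^sup>2 / ?p \<le> (norm (\<mu> n))\<^sup>2 / 1" "0 \<le> (norm (\<mu> n))\<^sup>2 / ?p"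
        using DIM_positive[where 'a='a] by (intro frac_le) auto
      then show ?thesis using sq_le[OF that, of n] zero_le_power2[of "\<mu> n \<bullet> x"]
        unfolding h_def by linarith
    qed
    have h_mean: "(\<integral>x. h n x \<partial>sphere_unif) = 0" for n
    proof -
      have "integrable sphere_unif (\<lambda>x. (\<mu> n \<bullet> x)\<^sup>2)"
        using sq_le by (intro integrable_sphere_unif[where B="(norm (\<mu> n))\<^sup>2"]) auto
      then show ?thesis
        using U.prob_space[where 'a='a] by (simp add: h_def integral_sphere_unif_inner_power2)
    qed
    have h_sq: "(\<integral>x. (h n x)\<^sup>2 \<partial>sphere_unif) \<le> ((norm (\<mu> n))\<^sup>2)\<^sup>2" for n
    proof -
      have le: "(h n x)\<^sup>2 \<le> ((norm (\<mu> n))\<^sup>2)\<^sup>2" if "norm x = 1" for x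
        using power_mono[OF h_bd[OF that, of n], of 2] by simp
      have "(\<integral>x. (h n x)\<^sup>2 \<partial>sphere_unif) \<le> (\<integral>x. ((norm (\<mu> n))\<^sup>2)\<^sup>2 \<partial>(sphere_unif :: 'a measure))"
        using le h_meas[of n]
        by (intro integral_sphere_unif_mono integrable_sphere_unif[where B="((norm (\<mu> n))\<^sup>2)\<^sup>2"]) auto
      then show ?thesis using U.prob_space[where 'a='a] by simp
    qed
    have D': "eventually (\<lambda>n. dist (real n * ln (?E n) - a / 2 * (norm (\<tau> n))\<^sup>2) 0 < \<epsilon> / 4) sequentially"
      using \<epsilon> by (intro tendstoD[OF D]) simp
    have bound: "eventually (\<lambda>n. measure (P_null n) {\<omega> \<in> space (P_null n). \<bar>?Z n \<omega>\<bar> > \<epsilon>}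
        \<le> ?p\<^sup>2 * (C\<^sup>2)\<^sup>2 / b\<^sup>2 / real n) sequentially"
      using mu_small[OF d(1)] tau2 eventually_ge_at_top[of 1] D'
    proof eventually_elim
      case (elim n)
      have n: "n \<ge> 1" by fact
      let ?D = "real n * ln (?E n) - a / 2 * (norm (\<tau> n))\<^sup>2"
      have D_small: "\<bar>?D\<bar> < \<epsilon> / 4" using elim(4) \<epsilon> by (simp add: dist_real_def)
      \<comment> \<open>An inclusion of events up to a null set, as the explicit log-likelihood
        ratio is only an almost-everywhere identity.\<close>
      have "AE \<omega> in P_null n. \<bar>?Z n \<omega>\<bar> > \<epsilon> \<longrightarrow> b \<le> \<bar>\<Sum>i\<in>{1..n}. h n (\<omega> i)\<bar>"
        using log_likelihood_ratio_P_loc[OF f_pos f_mono f_0, of n "\<mu> n"] AE_space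
      proof eventually_elim
        case (elim \<omega>)
        let ?V = "\<Sum>i\<in>{1..n}. h n (\<omega> i)"
        let ?S2 = "\<Sum>i\<in>{1..n}. (\<mu> n \<bullet> \<omega> i)\<^sup>2"
        define R where "R = (\<Sum>i\<in>{1..n}. ln (f (\<mu> n \<bullet> \<omega> i)) - \<mu> n \<bullet> \<omega> i - (a - 1) / 2 * (\<mu> n \<bullet> \<omega> i)\<^sup>2)"
        have nrm: "norm (\<omega> i) = 1" if "i \<in> {1..n}" for i
          using space_P_null_norm[OF elim(2) that] .
        have "\<bar>R\<bar> \<le> (\<Sum>i\<in>{1..n}. \<eta> * (norm (\<mu> n))\<^sup>2)"
          unfolding R_def
        proof (rule order_trans[OF sum_abs], rule sum_mono)
          fix i assume i: "i \<in> {1..n}"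
          have "\<bar>ln (f (\<mu> n \<bullet> \<omega> i)) - \<mu> n \<bullet> \<omega> i - (a - 1) / 2 * (\<mu> n \<bullet> \<omega> i)\<^sup>2\<bar> \<le> \<eta> * (\<mu> n \<bullet> \<omega> i)\<^sup>2"
            using abs_inner_sphere_le[OF nrm[OF i], of "\<mu> n"] \<open>norm (\<mu> n) \<le> d\<close> by (intro d(2)) linarith
          also have "\<dots> \<le> \<eta> * (norm (\<mu> n))\<^sup>2"
            using \<eta> by (intro mult_left_mono sq_le nrm i) auto
          finally show "\<bar>ln (f (\<mu> n \<bullet> \<omega> i)) - \<mu> n \<bullet> \<omega> i - (a - 1) / 2 * (\<mu> n \<bullet> \<omega> i)\<^sup>2\<bar> \<le> \<eta> * (norm (\<mu> n))\<^sup>2" .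
        qed
        also have "\<dots> = \<eta> * (?p * (norm (\<tau> n))\<^sup>2)"
          by (simp add: norm_mu[OF n, symmetric])
        also have "\<dots> \<le> \<eta> * (?p * (C\<^sup>2 + 1))"
          using \<eta> p \<open>(norm (\<tau> n))\<^sup>2 \<le> C\<^sup>2\<close> by (intro mult_left_mono) auto
        also have "\<dots> = \<epsilon> / 4"
        proof -
          have "C\<^sup>2 + 1 \<noteq> 0" using add_nonneg_pos[of "C\<^sup>2" 1] by simp
          then have "4 * ?p * (C\<^sup>2 + 1) \<noteq> 0" using p by simp
          then have "\<eta> * (4 * ?p * (C\<^sup>2 + 1)) = \<epsilon>" unfolding \<eta>_def by (rule nonzero_eq_divide_eq[THEN iffD1]) (rule refl)
          moreover have "\<eta> * (4 * ?p * (C\<^sup>2 + 1)) = 4 * (\<eta> * (?p * (C\<^sup>2 + 1)))" by (simp only: ac_simps)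
          ultimately show ?thesis by linarith
        qed
        finally have R: "\<bar>R\<bar> \<le> \<epsilon> / 4" .
        have V: "?V = ?S2 - (norm (\<tau> n))\<^sup>2"
        proof -
          have "?V = ?S2 - (real n * (norm (\<mu> n))\<^sup>2) / ?p"
            by (simp add: h_def sum_subtractf)
          then show ?thesis unfolding norm_mu[OF n] using p by simp
        qed
        have Delta: "\<tau> n \<bullet> Delta n \<omega> = (\<Sum>i\<in>{1..n}. \<mu> n \<bullet> \<omega> i)"
        proof -
          have "sqrt (real n * ?p) * (1 / real n) = sqrt (?p / real n)"
            using n by (simp add: real_sqrt_mult real_sqrt_divide field_simps)
          then show ?thesis
            by (simp add: Delta_def sample_mean_def mu[OF n] inner_sum_right sum_distrib_left)
        qed
        have "R = (\<Sum>i\<in>{1..n}. ln (f (\<mu> n \<bullet> \<omega> i))) - (\<Sum>i\<in>{1..n}. \<mu> n \<bullet> \<omega> i) - (a - 1) / 2 * ?S2"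
          unfolding R_def by (simp add: sum_subtractf sum_distrib_left)
        then have Z: "?Z n \<omega> = R + (a - 1) / 2 * ?V - ?D"
          unfolding elim(1) Delta V by (simp add: field_simps)
        show ?case
        proof
          assume "\<bar>?Z n \<omega>\<bar> > \<epsilon>"
          then have "\<bar>(a - 1) / 2 * ?V\<bar> > \<epsilon> / 2"
            using R D_small unfolding Z by linarith
          then have "\<epsilon> < \<bar>a - 1\<bar> * \<bar>?V\<bar>"
            by (simp add: abs_mult)
          also have "\<dots> \<le> (\<bar>a - 1\<bar> + 1) * \<bar>?V\<bar>"
            by (rule mult_right_mono) auto
          finally show "b \<le> \<bar>?V\<bar>"
            by (simp add: b_def field_simps)
        qed
      qed
      then have "measure (P_null n) {\<omega> \<in> space (P_null n). \<bar>?Z n \<omega>\<bar> > \<epsilon>}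
          \<le> measure (P_null n) {\<omega> \<in> space (P_null n). \<bar>\<Sum>i\<in>{1..n}. h n (\<omega> i)\<bar> \<ge> b}"
        using measurable_P_null_component[OF _ h_meas]
        by (intro P.finite_measure_mono_AE) (auto intro!: borel_measurable_le borel_measurable_abs borel_measurable_sum)
      also have "\<dots> \<le> real n * (\<integral>x. (h n x)\<^sup>2 \<partial>sphere_unif) / b\<^sup>2"
        by (rule P_null_sum_tail[OF h_meas h_bd h_mean b])
      also have "\<dots> \<le> real n * ((norm (\<mu> n))\<^sup>2)\<^sup>2 / b\<^sup>2"
        by (intro divide_right_mono mult_left_mono h_sq) auto
      \<comment> \<open>Regrouping exposes the bounded quantity
        \<open>real n * (norm (\<mu> n))\<^sup>2\<close>; what remains is a rate of 1/n.\<close>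
      also have "real n * ((norm (\<mu> n))\<^sup>2)\<^sup>2 = (real n * (norm (\<mu> n))\<^sup>2)\<^sup>2 / real n"
        using n by (simp add: power2_eq_square)
      also have "(real n * (norm (\<mu> n))\<^sup>2)\<^sup>2 / real n / b\<^sup>2 \<le> (?p * C\<^sup>2)\<^sup>2 / real n / b\<^sup>2"
        unfolding norm_mu[OF n] by (intro divide_right_mono power_mono mult_left_mono elim(2)) auto
      finally show ?case by (simp add: power_mult_distrib field_simps)
    qed
    have lim: "(\<lambda>n. ?p\<^sup>2 * (C\<^sup>2)\<^sup>2 / b\<^sup>2 / real n) \<longlonglongrightarrow> 0"
      by (intro tendsto_divide_0[OF tendsto_const] filterlim_at_top_imp_at_infinity filterlim_real_sequentially)
    show ?thesis
      by (rule Lim_null_comparison[OF eventually_mono[OF bound] lim])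
        (simp only: real_norm_def abs_of_nonneg measure_nonneg)
  qed
  ultimately show ?thesis unfolding small_oP1_def by blast
qed

section \<open>Weak convergence from characteristic functions\<close>

text \<open>A complex coefficient treats sine and cosine as one case, and makes the integral of each
  term the real part of \<open>c\<close> times the characteristic function at
  \<open>t\<close>.\<close>

inductive trig_sum :: "('a::euclidean_space \<Rightarrow> real) \<Rightarrow> bool" where
  base: "trig_sum (\<lambda>x. Re (c * iexp (t \<bullet> x)))"
| add: "trig_sum f \<Longrightarrow> trig_sum g \<Longrightarrow> trig_sum (\<lambda>x. f x + g x)"

lemma trig_sum_const: "trig_sum (\<lambda>_. r)"
  using trig_sum.base[of "complex_of_real r" 0] by simp

text \<open>Product-to-sum formula in complex form: Re z Re w is half of Re (z w) + Re (z cnj w),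
  which produces the frequencies \<open>t + s\<close> and \<open>t - s\<close>.\<close>

lemma trig_sum_mult:
  assumes "trig_sum f" "trig_sum g"
  shows "trig_sum (\<lambda>x. f x * g x)"
  using assms(1)
proof induction
  case (base c t)
  from assms(2) show ?case
  proof induction
    case (base d s)
    have "Re (c * iexp (t \<bullet> x)) * Re (d * iexp (s \<bullet> x)) =
      Re (c * d / 2 * iexp ((t + s) \<bullet> x)) + Re (c * cnj d / 2 * iexp ((t - s) \<bullet> x))" for x
    proof -
      have "iexp ((t + s) \<bullet> x) = iexp (t \<bullet> x) * iexp (s \<bullet> x)"
        by (simp add: inner_add_left distrib_left exp_add)
      moreover have "iexp ((t - s) \<bullet> x) = iexp (t \<bullet> x) * cnj (iexp (s \<bullet> x))"
        by (simp add: inner_diff_left right_diff_distrib exp_diff exp_cnj exp_minus field_simps)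
      moreover have "Re z * Re w = Re (z * w / 2) + Re (z * cnj w / 2)" for z w
        by (simp add: field_simps)
      note this[of "c * iexp (t \<bullet> x)" "d * iexp (s \<bullet> x)"]
      ultimately show ?thesis by (simp only: complex_cnj_mult ac_simps times_divide_eq_left times_divide_eq_right)
    qed
    then show ?case
      by (simp only:) (intro trig_sum.intros)
  next
    case (add g1 g2)
    then show ?case by (simp only: distrib_left) (rule trig_sum.add)
  qed
next
  case (add f1 f2)
  then show ?case by (simp only: distrib_right) (rule trig_sum.add)
qed

lemma trig_sum_sum:
  assumes "finite I" "\<And>i. i \<in> I \<Longrightarrow> trig_sum (f i)"
  shows "trig_sum (\<lambda>x. \<Sum>i\<in>I. f i x)"
  using assms by (induction I) (auto intro: trig_sum_const trig_sum.add)

lemma trig_sum_sin: "trig_sum (\<lambda>x. sin (t \<bullet> x))"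
  using trig_sum.base[of "- \<i>" t] by (simp add: Re_exp Im_exp)

text \<open>A linear functional of the vector of sines is a trigonometric sum, and these sums are
  closed under the operations that generate polynomials.\<close>

lemma trig_sum_polynomial:
  assumes "real_polynomial_function P"
  shows "trig_sum (\<lambda>x. P (\<Sum>b\<in>Basis. sin (c * (x \<bullet> b)) *\<^sub>R b))"
  using assms
proof induction
  case (linear h)
  have "h (\<Sum>b\<in>Basis. sin (c * (x \<bullet> b)) *\<^sub>R b) = (\<Sum>b\<in>Basis. h b * sin ((c *\<^sub>R b) \<bullet> x))" for x :: 'a
  proof -
    interpret bounded_linear h by fact
    show ?thesis by (simp add: sum scaleR inner_commute mult.commute)
  qed
  then show ?case
    by (simp only:) (intro trig_sum_sum trig_sum_mult trig_sum_const trig_sum_sin finite_Basis)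
qed (intro trig_sum_const trig_sum.add trig_sum_mult; assumption)+

lemma integrable_bounded_continuous:
  fixes g :: "'a::euclidean_space \<Rightarrow> 'b::{banach,second_countable_topology}"
  assumes "prob_space M" "sets M = sets borel" "continuous_on UNIV g" "\<And>x. norm (g x) \<le> B"
  shows "integrable M g"
proof -
  interpret prob_space M by fact
  have "g \<in> borel_measurable M"
    using borel_measurable_continuous_onI[OF assms(3)] assms(2) by (simp cong: measurable_cong_sets)
  then show ?thesis using assms(4) by (intro integrable_const_bound[where B=B]) auto
qed

lemma integrable_iexp_inner:
  fixes t :: "'a::euclidean_space"
  assumes "prob_space M" "sets M = sets borel"
  shows "integrable M (\<lambda>x. iexp (t \<bullet> x))"
  by (rule integrable_bounded_continuous[OF assms, where B=1]) (auto intro!: continuous_intros)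

lemma trig_sum_integrable:
  assumes "trig_sum f" "prob_space M" "sets M = sets borel"
  shows "integrable M f"
  using assms(1)
  by induction (auto intro!: integrable_Re integrable_mult_right integrable_iexp_inner assms(2,3))

lemma trig_sum_integral_tendsto:
  fixes M :: "nat \<Rightarrow> 'a::euclidean_space measure"
  assumes "trig_sum f"
    and M: "\<And>n. prob_space (M n)" "\<And>n. sets (M n) = sets borel"
    and N: "prob_space N" "sets N = sets borel"
    and char: "\<And>t. (\<lambda>n. \<integral>x. iexp (t \<bullet> x) \<partial>M n) \<longlonglongrightarrow> (\<integral>x. iexp (t \<bullet> x) \<partial>N)"
  shows "(\<lambda>n. \<integral>x. f x \<partial>M n) \<longlonglongrightarrow> (\<integral>x. f x \<partial>N)"
  using assms(1)
proof induction
  case (base c t)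
  have "(\<integral>x. Re (c * iexp (t \<bullet> x)) \<partial>L) = Re (c * (\<integral>x. iexp (t \<bullet> x) \<partial>L))"
    if "prob_space L" "sets L = sets borel" for L
    using integrable_iexp_inner[OF that, of t] by (subst integral_Re) auto
  then show ?case
    using M N by (simp only:) (intro tendsto_intros char)
next
  case (add f g)
  have "(\<integral>x. f x + g x \<partial>L) = (\<integral>x. f x \<partial>L) + (\<integral>x. g x \<partial>L)"
    if "prob_space L" "sets L = sets borel" for L
    using add(1,2) that by (intro Bochner_Integration.integral_add trig_sum_integrable)
  then show ?case
    using M N add by (simp only:) (intro tendsto_add)
qed

text \<open>Substituting \<open>s = sin (\<pi> x / 2K)\<close> turns a Weierstrass approximation on \<open>[-1, 1]\<^sup>d\<close> into a
  trigonometric one that is close to \<open>g\<close> on \<open>[-K, K]\<^sup>d\<close> and bounded everywhere.\<close>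
lemma trig_sum_approx:
  fixes g :: "'a::euclidean_space \<Rightarrow> real"
  assumes g: "continuous_on UNIV g" and B: "\<And>x. \<bar>g x\<bar> \<le> B" and K: "K > 0" and e: "e > 0"
  obtains T where "trig_sum T" "\<And>x. \<bar>T x\<bar> \<le> B + e" "\<And>x. norm x \<le> K \<Longrightarrow> \<bar>g x - T x\<bar> \<le> e"
proof -
  let ?S = "cbox (- One) (One :: 'a)"
  \<comment> \<open>With this scale, \<open>norm x \<le> K\<close> keeps every
    \<open>c * (x \<bullet> b)\<close> in the interval around 0 of half-width \<open>pi / 2\<close>,
    where \<open>arcsin\<close> inverts \<open>sin\<close>.\<close>
  define c where "c = pi / (2 * K)"
  have c: "c > 0" using K by (simp add: c_def)
  define \<phi> where "\<phi> x = (\<Sum>b\<in>Basis. sin (c * (x \<bullet> b)) *\<^sub>R b)" for x :: 'a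
  define \<psi> where "\<psi> s = (\<Sum>b\<in>Basis. (arcsin (s \<bullet> b) / c) *\<^sub>R b)" for s :: 'a
  have "continuous_on ?S \<psi>"
    unfolding \<psi>_def using c by (intro continuous_intros) (auto simp: mem_box)
  then have "continuous_on ?S (\<lambda>s. g (\<psi> s))"
    by (rule continuous_on_compose2[OF g]) auto
  then obtain P where P: "real_polynomial_function P" "\<And>s. s \<in> ?S \<Longrightarrow> \<bar>g (\<psi> s) - P s\<bar> < e"
    using Stone_Weierstrass_real_polynomial_function[OF compact_cbox _ e] by metis
  have \<phi>: "\<phi> x \<in> ?S" for x
    by (auto simp: mem_box \<phi>_def inner_sum_left inner_Basis if_distrib sum.delta cong: if_cong)
  have "\<psi> (\<phi> x) = x" if x: "norm x \<le> K" for x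
  proof (rule euclidean_eqI)
    fix b :: 'a assume b: "b \<in> Basis"
    have "\<bar>x \<bullet> b\<bar> \<le> K" using Basis_le_norm[OF b, of x] x by linarith
    then have "\<bar>c * (x \<bullet> b)\<bar> \<le> c * K" using c by (simp add: abs_mult)
    then have "\<bar>c * (x \<bullet> b)\<bar> \<le> pi / 2" using K by (simp add: c_def)
    then have "arcsin (sin (c * (x \<bullet> b))) = c * (x \<bullet> b)"
      by (intro arcsin_sin) linarith+
    then show "\<psi> (\<phi> x) \<bullet> b = x \<bullet> b"
      using c b by (simp add: \<psi>_def \<phi>_def inner_sum_left inner_Basis if_distrib sum.delta cong: if_cong)
  qed
  then have "\<bar>g x - P (\<phi> x)\<bar> \<le> e" if "norm x \<le> K" for x
    using P(2)[OF \<phi>, of x] that by simp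
  \<comment> \<open>Holds for every \<open>x\<close>: \<open>\<phi>\<close> always lands in the
    cube, where \<open>P\<close> is within \<open>e\<close> of a function bounded by
    \<open>B\<close>.\<close>
  moreover have "\<bar>P (\<phi> x)\<bar> \<le> B + e" for x
    using P(2)[OF \<phi>, of x] B[of "\<psi> (\<phi> x)"] by linarith
  moreover have "trig_sum (\<lambda>x. P (\<phi> x))"
    unfolding \<phi>_def by (rule trig_sum_polynomial[OF P(1)])
  ultimately show ?thesis using that by blast
qed

lemma integral_diff_tail_bound:
  fixes g h :: "'a::euclidean_space \<Rightarrow> real"
  assumes M: "prob_space M" "sets M = sets borel" and int: "integrable M g" "integrable M h"
    and K: "\<And>x. norm x \<le> K \<Longrightarrow> \<bar>g x - h x\<bar> \<le> e" and B: "\<And>x. \<bar>g x - h x\<bar> \<le> B"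
    and tail: "measure M {x. norm x > K} \<le> e" and e: "e > 0"
  shows "\<bar>(\<integral>x. g x \<partial>M) - (\<integral>x. h x \<partial>M)\<bar> \<le> e + B * e"
proof -
  interpret prob_space M by fact
  let ?A = "{x::'a. norm x > K}"
  have A: "?A \<in> sets M" unfolding M(2) by measurable
  have B0: "B \<ge> 0" using B[of 0] by linarith
  have "\<bar>(\<integral>x. g x \<partial>M) - (\<integral>x. h x \<partial>M)\<bar> = \<bar>\<integral>x. g x - h x \<partial>M\<bar>"
    using int by simp
  also have "\<dots> \<le> (\<integral>x. \<bar>g x - h x\<bar> \<partial>M)"
    by (rule integral_abs_bound)
  also have "\<dots> \<le> (\<integral>x. e + B * indicator ?A x \<partial>M)"
  proof (rule integral_mono)
    fix x
    show "\<bar>g x - h x\<bar> \<le> e + B * indicator ?A x"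
      using K[of x] B[of x] e by (auto simp: indicator_def not_less)
    show "integrable M (\<lambda>x. e + B * indicator ?A x)"
      using A by (intro Bochner_Integration.integrable_add integrable_mult_right integrable_real_indicator)
        (auto simp: emeasure_eq_measure)
  qed (use int in auto)
  also have "\<dots> = e + B * measure M ?A"
    using A by (subst Bochner_Integration.integral_add)
      (auto simp: prob_space emeasure_eq_measure intro!: integrable_mult_right integrable_real_indicator)
  also have "\<dots> \<le> e + B * e"
    using tail B0 by (simp add: mult_left_mono)
  finally show ?thesis .
qed

text \<open>The complements of growing balls decrease to the empty set, so continuity from above
  applies.\<close>

lemma prob_space_tight:
  fixes N :: "'a::euclidean_space measure"
  assumes N: "prob_space N" "sets N = sets borel" and e: "e > 0"
  obtains K where "measure N {x. norm x > K} \<le> e"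
proof -
  interpret prob_space N by fact
  let ?A = "\<lambda>n. {x::'a. norm x > real n}"
  have "(\<lambda>n. measure N (?A n)) \<longlonglongrightarrow> measure N (\<Inter>n. ?A n)"
  proof (rule finite_Lim_measure_decseq)
    show "range ?A \<subseteq> sets N" unfolding N(2) by (auto intro!: borel_open open_Collect_less continuous_intros)
    show "decseq ?A" by (auto simp: decseq_def)
  qed
  moreover have "(\<Inter>n. ?A n) = {}"
  proof -
    have "\<exists>n. norm x \<le> real n" for x :: 'a
      using real_arch_simple .
    then show ?thesis by (simp add: set_eq_iff not_less)
  qed
  ultimately have "(\<lambda>n. measure N (?A n)) \<longlonglongrightarrow> 0" by simp
  from order_tendstoD(2)[OF this e] obtain n where "measure N (?A n) < e"
    by (auto dest: eventually_happens)
  then show ?thesis by (intro that[of "real n"]) simp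
qed

text \<open>The approximating sum is close to \<open>g\<close> only on a ball. Tightness makes the
  error outside small under every late \<open>M n\<close>, with one radius for all of them.\<close>

lemma weak_conv_to_of_char:
  fixes M :: "nat \<Rightarrow> 'a::euclidean_space measure"
  assumes M: "\<And>n. prob_space (M n)" "\<And>n. sets (M n) = sets borel"
    and N: "prob_space N" "sets N = sets borel"
    and char: "\<And>t. (\<lambda>n. \<integral>x. iexp (t \<bullet> x) \<partial>M n) \<longlonglongrightarrow> (\<integral>x. iexp (t \<bullet> x) \<partial>N)"
    and tight: "\<And>e. e > 0 \<Longrightarrow> \<exists>K. eventually (\<lambda>n. measure (M n) {x. norm x > K} \<le> e) sequentially"
  shows "weak_conv_to M N"
  unfolding weak_conv_to_def
proof (intro allI impI)
  fix g :: "'a \<Rightarrow> real"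
  assume g: "continuous_on UNIV g" and "bounded (range g)"
  then obtain B where B: "\<And>x. \<bar>g x\<bar> \<le> B"
    unfolding bounded_iff by auto
  have B0: "B \<ge> 0" using B[of 0] by linarith
  show "(\<lambda>n. \<integral>x. g x \<partial>M n) \<longlonglongrightarrow> (\<integral>x. g x \<partial>N)"
  proof (rule tendstoI)
    fix \<epsilon> :: real assume \<epsilon>: "\<epsilon> > 0"
    \<comment> \<open>For \<open>e \<le> 1\<close> an approximation error
      \<open>e + (2 * B + e) * e\<close> is at most \<open>2 * ((B + 1) * e)\<close>, hence at most
      \<open>\<epsilon> / 4\<close>. It occurs under \<open>M n\<close> and under \<open>N\<close>;
      a third quarter goes to the convergence of the integrals of \<open>T\<close>.\<close>
    define e where "e = min 1 (\<epsilon> / (8 * (B + 1)))"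
    have e: "e > 0" "e \<le> 1" using \<epsilon> B0 by (auto simp: e_def)
    have "e \<le> \<epsilon> / (8 * (B + 1))" by (simp add: e_def)
    then have e8: "8 * ((B + 1) * e) \<le> \<epsilon>" using B0 by (simp add: field_simps)
    obtain K1 where K1: "eventually (\<lambda>n. measure (M n) {x. norm x > K1} \<le> e) sequentially"
      using tight[OF e(1)] by blast
    obtain K2 where K2: "measure N {x. norm x > K2} \<le> e"
      using prob_space_tight[OF N e(1)] .
    define K where "K = max 1 (max K1 K2)"
    have K_pos: "K > 0" and K_ge: "K1 \<le> K" "K2 \<le> K" by (simp_all add: K_def)
    have tail_mono: "measure L {x. norm x > K} \<le> measure L {x. norm x > K'}"
      if "prob_space L" "sets L = sets borel" "K' \<le> K" for L :: "'a measure" and K'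
    proof -
      interpret L: prob_space L by fact
      show ?thesis
        using that(3) by (intro L.finite_measure_mono) (auto simp: that(2))
    qed
    obtain T where T: "trig_sum T" "\<And>x. \<bar>T x\<bar> \<le> B + e" "\<And>x. norm x \<le> K \<Longrightarrow> \<bar>g x - T x\<bar> \<le> e"
      using trig_sum_approx[OF g B K_pos e(1)] by metis
    have bd: "\<bar>g x - T x\<bar> \<le> 2 * B + e" for x
      using B[of x] T(2)[of x] by linarith
    have approx: "\<bar>(\<integral>x. g x \<partial>L) - (\<integral>x. T x \<partial>L)\<bar> \<le> 2 * ((B + 1) * e)"
      if L: "prob_space L" "sets L = sets borel" and tail: "measure L {x. norm x > K} \<le> e" for L
    proof -
      have "\<bar>(\<integral>x. g x \<partial>L) - (\<integral>x. T x \<partial>L)\<bar> \<le> e + (2 * B + e) * e"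
        using B by (intro integral_diff_tail_bound[OF L _ _ T(3) bd tail e(1)]
            integrable_bounded_continuous[OF L g] trig_sum_integrable[OF T(1) L]) auto
      also have "\<dots> \<le> 2 * ((B + 1) * e)"
        using mult_right_mono[of e 1 e] e by (simp add: algebra_simps)
      finally show ?thesis .
    qed
    have N_approx: "\<bar>(\<integral>x. g x \<partial>N) - (\<integral>x. T x \<partial>N)\<bar> \<le> 2 * ((B + 1) * e)"
      by (intro approx N order_trans[OF tail_mono[OF N K_ge(2)] K2])
    have "eventually (\<lambda>n. dist (\<integral>x. T x \<partial>M n) (\<integral>x. T x \<partial>N) < \<epsilon> / 4) sequentially"
      using \<epsilon> by (intro tendstoD[OF trig_sum_integral_tendsto[OF T(1) M N char]]) simp
    then show "eventually (\<lambda>n. dist (\<integral>x. g x \<partial>M n) (\<integral>x. g x \<partial>N) < \<epsilon>) sequentially"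
      using K1
    proof eventually_elim
      case (elim n)
      have "\<bar>(\<integral>x. g x \<partial>M n) - (\<integral>x. T x \<partial>M n)\<bar> \<le> 2 * ((B + 1) * e)"
        by (intro approx M order_trans[OF tail_mono[OF M K_ge(1)] elim(2)])
      then show ?case
        using elim(1) N_approx e8 \<epsilon> unfolding dist_real_def by linarith
    qed
  qed
qed

section \<open>The standard normal law as a product and its characteristic function\<close>

lemma std_mvn_eq_distr:
  "(std_mvn :: 'a::euclidean_space measure) =
    distr (PiM Basis (\<lambda>_. std_normal_distribution)) borel (\<lambda>f. \<Sum>b\<in>Basis. f b *\<^sub>R b)"
proof -
  let ?T = "\<lambda>f. \<Sum>b\<in>Basis. f b *\<^sub>R b :: 'a"
  interpret N: prob_space std_normal_distribution
    by (rule prob_space_normal_density) simp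
  have T: "?T f \<bullet> b = f b" if "b \<in> Basis" for f b
    using that by (simp add: inner_sum_left inner_Basis if_distrib sum.delta cong: if_cong)
  have "PiM (Basis :: 'a set) (\<lambda>_. std_normal_distribution) =
      density (PiM Basis (\<lambda>_. lborel)) (\<lambda>f. \<Prod>b\<in>Basis. ennreal (std_normal_density (f b)))"
    by (rule PiM_density)
      (auto simp: product_sigma_finite_def N.sigma_finite_measure_axioms lborel.sigma_finite_measure_axioms)
  also have "(\<lambda>f. \<Prod>b\<in>(Basis :: 'a set). ennreal (std_normal_density (f b))) =
      (\<lambda>f. ennreal (\<Prod>b\<in>Basis. std_normal_density (?T f \<bullet> b)))"
    by (simp add: prod_ennreal T)
  \<comment> \<open>The product density depends on \<open>f\<close> only through its image under
    \<open>?T\<close>, so it can be pushed forward; \<open>lborel_eq\<close> then identifies the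
    image of the product Lebesgue measure.\<close>
  finally have "distr (PiM Basis (\<lambda>_. std_normal_distribution)) borel ?T =
     density (distr (PiM Basis (\<lambda>_. lborel)) borel ?T) (\<lambda>x. ennreal (\<Prod>b\<in>Basis. std_normal_density (x \<bullet> b)))"
    by (simp only:) (rule density_distr[symmetric]; measurable)
  then show ?thesis
    unfolding std_mvn_def lborel_eq[symmetric] by simp
qed

lemma prob_space_std_mvn: "prob_space (std_mvn :: 'a::euclidean_space measure)"
proof -
  interpret N: prob_space std_normal_distribution
    by (rule prob_space_normal_density) simp
  have "prob_space (PiM (Basis :: 'a set) (\<lambda>_. std_normal_distribution))"
    by (rule prob_space_PiM) (rule N.prob_space_axioms)
  then show ?thesis
    unfolding std_mvn_eq_distr by (rule prob_space.prob_space_distr) measurable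
qed

lemma sets_std_mvn: "sets std_mvn = sets borel"
  by (simp add: std_mvn_def)

lemma char_std_mvn:
  fixes t :: "'a::euclidean_space"
  shows "(\<integral>x. iexp (t \<bullet> x) \<partial>std_mvn) = complex_of_real (exp (- (norm t)\<^sup>2 / 2))"
proof -
  interpret N: prob_space std_normal_distribution
    by (rule prob_space_normal_density) simp
  interpret PN: product_sigma_finite "\<lambda>_::'a. std_normal_distribution"
    by (simp add: product_sigma_finite_def N.sigma_finite_measure_axioms)
  have "(\<integral>x. iexp (t \<bullet> x) \<partial>std_mvn)
      = (\<integral>f. iexp (t \<bullet> (\<Sum>b\<in>Basis. f b *\<^sub>R b)) \<partial>PiM Basis (\<lambda>_. std_normal_distribution))"
    unfolding std_mvn_eq_distr by (rule integral_distr) measurable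
  also have "\<dots> = (\<integral>f. (\<Prod>b\<in>Basis. iexp ((t \<bullet> b) * f b)) \<partial>PiM Basis (\<lambda>_. std_normal_distribution))"
    by (simp add: inner_sum_right sum_distrib_left mult.commute flip: exp_sum)
  also have "\<dots> = (\<Prod>b\<in>Basis. char std_normal_distribution (t \<bullet> b))"
    unfolding char_def by (rule PN.product_integral_prod)
      (auto intro!: N.integrable_const_bound[where B=1])
  also have "\<dots> = complex_of_real (\<Prod>b\<in>Basis. exp (- (t \<bullet> b)\<^sup>2 / 2))"
    by (simp add: char_std_normal_distribution)
  also have "(\<Prod>b\<in>Basis. exp (- (t \<bullet> b)\<^sup>2 / 2)) = exp (- (norm t)\<^sup>2 / 2)"
    unfolding power2_norm_eq_inner euclidean_inner[of t t]
    by (simp add: power2_eq_square sum_negf sum_divide_distrib flip: exp_sum)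
  finally show ?thesis .
qed

section \<open>The normalised sample mean\<close>

lemma Delta_inner:
  "t \<bullet> Delta n \<omega> = (sqrt (real n * DIM('a)) / real n) * (\<Sum>i\<in>{1..n}. t \<bullet> \<omega> i)"
  for t :: "'a::euclidean_space"
  by (simp add: Delta_def sample_mean_def inner_sum_right)

text \<open>The squared scale p/n cancels the variance of the sum exactly. The covariance is thus
  the identity for each \<open>n \<ge> 1\<close>, which makes the tail bounds uniform in n.\<close>

lemma Delta_inner_second_moment:
  fixes t :: "'a::euclidean_space"
  assumes n: "n \<ge> 1"
  shows "integrable (P_null n) (\<lambda>\<omega>. (t \<bullet> Delta n \<omega>)\<^sup>2)"
    and "(\<integral>\<omega>. (t \<bullet> Delta n \<omega>)\<^sup>2 \<partial>P_null n) = (norm t)\<^sup>2"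
proof -
  have h: "(\<lambda>x. t \<bullet> x) \<in> borel_measurable borel" "\<And>x. norm x = 1 \<Longrightarrow> \<bar>t \<bullet> x\<bar> \<le> norm t"
    using abs_inner_sphere_le[of _ t] by auto
  note sum = integrable_P_null_sum_power2[OF h integral_sphere_unif_inner, of n]
    integral_P_null_sum_power2[OF h integral_sphere_unif_inner, of n]
  show "integrable (P_null n) (\<lambda>\<omega>. (t \<bullet> Delta n \<omega>)\<^sup>2)"
    unfolding Delta_inner power_mult_distrib using sum(1) by simp
  show "(\<integral>\<omega>. (t \<bullet> Delta n \<omega>)\<^sup>2 \<partial>P_null n) = (norm t)\<^sup>2"
  proof -
    have "(sqrt (real n * DIM('a)) / real n)\<^sup>2 = DIM('a) / real n"
      using n by (simp add: power_divide power2_eq_square)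
    then show ?thesis
      unfolding Delta_inner power_mult_distrib using n
      by (simp add: sum(2)[simplified] integral_sphere_unif_inner_power2)
  qed
qed

text \<open>Chebyshev with second moment \<open>DIM('a)\<close>, one unit per coordinate. This is
  the tightness of the laws of \<open>Delta n\<close>.\<close>

lemma Delta_tail:
  assumes n: "n \<ge> 1" and K: "K > 0"
  shows "measure (distr (P_null n) borel (Delta n)) {x::'a::euclidean_space. norm x > K} \<le> DIM('a) / K\<^sup>2"
proof -
  note [measurable] = measurable_Delta[of n, where 'a='a]
  have sq: "(norm x)\<^sup>2 = (\<Sum>b\<in>Basis. (b \<bullet> x)\<^sup>2)" for x :: 'a
    unfolding power2_norm_eq_inner euclidean_inner[of x x] by (simp add: inner_commute power2_eq_square)
  have int: "integrable (P_null n) (\<lambda>\<omega>. (norm (Delta n \<omega> :: 'a))\<^sup>2)"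
    unfolding sq using n by (intro Bochner_Integration.integrable_sum Delta_inner_second_moment)
  have "(\<integral>\<omega>. (norm (Delta n \<omega> :: 'a))\<^sup>2 \<partial>P_null n) = (\<Sum>b\<in>(Basis::'a set). \<integral>\<omega>. (b \<bullet> Delta n \<omega>)\<^sup>2 \<partial>P_null n)"
    unfolding sq using n by (intro Bochner_Integration.integral_sum Delta_inner_second_moment)
  also have "\<dots> = DIM('a)"
    using n by (simp add: Delta_inner_second_moment)
  finally have E: "(\<integral>\<omega>. (norm (Delta n \<omega> :: 'a))\<^sup>2 \<partial>P_null n) = DIM('a)" .
  have "measure (distr (P_null n) borel (Delta n)) {x::'a. norm x > K}
      = measure (P_null n) {\<omega> \<in> space (P_null n). norm (Delta n \<omega> :: 'a) > K}"
    by (subst measure_distr) (auto intro!: arg_cong[where f="measure (P_null n)"])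
  also have "\<dots> \<le> measure (P_null n) {\<omega> \<in> space (P_null n). \<bar>norm (Delta n \<omega> :: 'a)\<bar> \<ge> K}"
    by (intro P.finite_measure_mono) auto
  also have "\<dots> \<le> DIM('a) / K\<^sup>2"
    using P.second_moment_method[of "\<lambda>\<omega>. norm (Delta n \<omega> :: 'a)" n, OF _ int K] E by simp
  finally show ?thesis .
qed

lemma char_Delta_eq:
  fixes t :: "'a::euclidean_space"
  shows "(\<integral>\<omega>. iexp (t \<bullet> Delta n \<omega>) \<partial>P_null n)
    = (char (distr sphere_unif borel (\<lambda>x. t \<bullet> x)) (sqrt (real n * DIM('a)) / real n)) ^ n"
proof -
  let ?s = "sqrt (real n * DIM('a)) / real n"
  have meas: "(\<lambda>x. t \<bullet> x) \<in> borel_measurable sphere_unif"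
    by (intro borel_measurable_sphere_unif) measurable
  have "(\<integral>\<omega>. iexp (t \<bullet> Delta n \<omega>) \<partial>P_null n) = (\<integral>\<omega>. (\<Prod>i\<in>{1..n}. iexp (?s * (t \<bullet> \<omega> i))) \<partial>P_null n)"
    unfolding Delta_inner by (simp add: sum_distrib_left flip: exp_sum)
  also have "\<dots> = (\<Prod>i\<in>{1..n}. \<integral>x. iexp (?s * (t \<bullet> x)) \<partial>sphere_unif)"
    unfolding P_null_def using meas
    by (intro US.product_integral_prod) (auto intro!: integrable_sphere_unif[where B=1])
  also have "(\<integral>x. iexp (?s * (t \<bullet> x)) \<partial>sphere_unif) = char (distr sphere_unif borel (\<lambda>x. t \<bullet> x)) ?s"
    unfolding char_def using meas by (subst integral_distr) auto
  finally show ?thesis by simp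
qed

text \<open>Both the characteristic function at \<open>s n\<close> and its quadratic approximation
  lie in the unit disc, where n-th powers differ by at most n times the difference of the bases.
  That difference is cubic in \<open>s n\<close>, while \<open>(s n)\<^sup>2\<close> is of order
  1/n.\<close>

lemma char_Delta_tendsto:
  fixes t :: "'a::euclidean_space"
  shows "(\<lambda>n. \<integral>\<omega>. iexp (t \<bullet> Delta n \<omega>) \<partial>P_null n) \<longlonglongrightarrow> complex_of_real (exp (- (norm t)\<^sup>2 / 2))"
proof -
  let ?p = "real DIM('a)"
  let ?\<nu> = "distr sphere_unif borel (\<lambda>x. t \<bullet> x)"
  define s where "s n = sqrt (real n * ?p) / real n" for n
  have meas: "(\<lambda>x. t \<bullet> x) \<in> borel_measurable sphere_unif"
    by (intro borel_measurable_sphere_unif) measurable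
  have bd: "\<bar>t \<bullet> x\<bar> \<le> norm t" if "norm x = 1" for x
    using abs_inner_sphere_le[OF that] .
  have int1: "integrable sphere_unif (\<lambda>x. t \<bullet> x)"
    using bd by (intro integrable_sphere_unif[where B="norm t"]) auto
  have int2: "integrable sphere_unif (\<lambda>x. (t \<bullet> x)\<^sup>2)"
    using bd by (intro integrable_sphere_unif[where B="(norm t)\<^sup>2"]) (auto simp: abs_le_square_iff[symmetric])
  interpret \<nu>: real_distribution ?\<nu>
    by (rule U.real_distribution_distr[OF meas])
  have s2: "(s n)\<^sup>2 = ?p / real n" if "n \<ge> 1" for n
    using that by (simp add: s_def power_divide power2_eq_square)
  have char_bd: "cmod (char ?\<nu> u - complex_of_real (1 - u\<^sup>2 * ((norm t)\<^sup>2 / ?p) / 2)) \<le> u\<^sup>2 / 6 * (\<bar>u\<bar> * (norm t) ^ 3)" for u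
  proof -
    have "cmod (char ?\<nu> u - complex_of_real (1 - u\<^sup>2 * ((norm t)\<^sup>2 / ?p) / 2))
        \<le> u\<^sup>2 / 6 * (\<integral>x. min (6 * (t \<bullet> x)\<^sup>2) (\<bar>u\<bar> * \<bar>t \<bullet> x\<bar> ^ 3) \<partial>sphere_unif)"
      by (rule U.char_approx3'[OF meas int1 int2 integral_sphere_unif_inner _ refl])
        (simp add: integral_sphere_unif_inner integral_sphere_unif_inner_power2)
    \<comment> \<open>Bounded observations allow the cubic branch of the minimum everywhere.\<close>
    also have "(\<integral>x. min (6 * (t \<bullet> x)\<^sup>2) (\<bar>u\<bar> * \<bar>t \<bullet> x\<bar> ^ 3) \<partial>sphere_unif) \<le> (\<integral>x. \<bar>u\<bar> * (norm t) ^ 3 \<partial>(sphere_unif :: 'a measure))"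
    proof (rule integral_sphere_unif_mono)
      have le: "\<bar>u\<bar> * \<bar>t \<bullet> x\<bar> ^ 3 \<le> \<bar>u\<bar> * norm t ^ 3" if "norm x = 1" for x
        using bd[OF that] by (intro mult_left_mono power_mono) auto
      then show "min (6 * (t \<bullet> x)\<^sup>2) (\<bar>u\<bar> * \<bar>t \<bullet> x\<bar> ^ 3) \<le> \<bar>u\<bar> * norm t ^ 3" if "norm x = 1" for x
        using that by (auto intro: min.coboundedI2)
      show "integrable sphere_unif (\<lambda>x. min (6 * (t \<bullet> x)\<^sup>2) (\<bar>u\<bar> * \<bar>t \<bullet> x\<bar> ^ 3))"
      proof (rule integrable_sphere_unif[where B="\<bar>u\<bar> * norm t ^ 3"])
        fix x :: 'a assume "norm x = 1"
        then show "norm (min (6 * (t \<bullet> x)\<^sup>2) (\<bar>u\<bar> * \<bar>t \<bullet> x\<bar> ^ 3)) \<le> \<bar>u\<bar> * norm t ^ 3"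
          using le[of x] by (auto intro: min.coboundedI2)
      qed measurable
    qed simp
    also have "(\<integral>x. \<bar>u\<bar> * (norm t) ^ 3 \<partial>(sphere_unif :: 'a measure)) = \<bar>u\<bar> * (norm t) ^ 3"
      using U.prob_space[where 'a='a] by simp
    finally show ?thesis by (simp add: mult_left_mono)
  qed
  have main: "eventually (\<lambda>n. norm ((char ?\<nu> (s n)) ^ n - complex_of_real ((1 + (- (norm t)\<^sup>2 / 2) / n) ^ n))
      \<le> ?p / 6 * (norm t) ^ 3 * \<bar>s n\<bar>) sequentially"
    \<comment> \<open>From \<open>(norm t)\<^sup>2 \<le> real n\<close> it follows that
      \<open>?w\<close> lies between 0 and 1, as the comparison of powers requires.\<close>
    using eventually_ge_at_top[of "max 1 (nat \<lceil>(norm t)\<^sup>2\<rceil>)"]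
  proof eventually_elim
    case (elim n)
    then have n: "n \<ge> 1" and "(norm t)\<^sup>2 \<le> real n"
      by (auto simp: nat_ceiling_le_eq)
    then have small: "(norm t)\<^sup>2 / 2 / real n \<le> 1" "0 \<le> (norm t)\<^sup>2 / 2 / real n"
      by (auto simp: field_simps)
    let ?w = "1 + (- (norm t)\<^sup>2 / 2) / real n"
    have w: "1 - (s n)\<^sup>2 * ((norm t)\<^sup>2 / ?p) / 2 = ?w"
      unfolding s2[OF n] by simp
    have "norm ((char ?\<nu> (s n)) ^ n - complex_of_real (?w ^ n))
        = norm ((char ?\<nu> (s n)) ^ n - (complex_of_real ?w) ^ n)"
      by simp
    also have "\<dots> \<le> real n * norm (char ?\<nu> (s n) - complex_of_real ?w)"
    proof (rule norm_power_diff[OF \<nu>.cmod_char_le_1])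
      have "\<bar>?w\<bar> \<le> 1" using small by simp
      then show "cmod (complex_of_real ?w) \<le> 1" by (simp only: norm_of_real)
    qed
    also have "\<dots> \<le> real n * ((s n)\<^sup>2 / 6 * (\<bar>s n\<bar> * (norm t) ^ 3))"
      using char_bd[of "s n"] unfolding w by (intro mult_left_mono) simp_all
    \<comment> \<open>Since n times \<open>(s n)\<^sup>2\<close> is \<open>?p\<close>, exactly one
      factor \<open>\<bar>s n\<bar>\<close> survives.\<close>
    also have "\<dots> = ?p / 6 * (norm t) ^ 3 * \<bar>s n\<bar>"
      unfolding s2[OF n] using n by simp
    finally show ?case .
  qed
  have "s \<longlonglongrightarrow> 0"
    unfolding s_def by real_asymp
  then have lim: "(\<lambda>n. ?p / 6 * (norm t) ^ 3 * \<bar>s n\<bar>) \<longlonglongrightarrow> 0"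
    by (auto intro!: tendsto_eq_intros)
  have "(\<lambda>n. complex_of_real ((1 + (- (norm t)\<^sup>2 / 2) / n) ^ n)) \<longlonglongrightarrow> complex_of_real (exp (- (norm t)\<^sup>2 / 2))"
    by (intro tendsto_of_real tendsto_exp_limit_sequentially)
  then have "(\<lambda>n. (char ?\<nu> (s n)) ^ n) \<longlonglongrightarrow> complex_of_real (exp (- (norm t)\<^sup>2 / 2))"
    by (rule Lim_transform) (rule Lim_null_comparison[OF main lim])
  then show ?thesis
    unfolding char_Delta_eq s_def .
qed

lemma weak_conv_to_Delta:
  "weak_conv_to (\<lambda>n. distr (P_null n) borel (Delta n)) (std_mvn :: 'a::euclidean_space measure)"
proof (rule weak_conv_to_of_char)
  let ?D = "\<lambda>n. distr (P_null n) borel (Delta n :: _ \<Rightarrow> 'a)"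
  show "prob_space (?D n)" for n
    by (rule P.prob_space_distr[OF measurable_Delta])
  show "(\<lambda>n. \<integral>x. iexp (t \<bullet> x) \<partial>?D n) \<longlonglongrightarrow> (\<integral>x. iexp (t \<bullet> x) \<partial>std_mvn)" for t :: 'a
  proof -
    have "(\<integral>x. iexp (t \<bullet> x) \<partial>?D n) = (\<integral>\<omega>. iexp (t \<bullet> Delta n \<omega>) \<partial>P_null n)" for n
      by (rule integral_distr[OF measurable_Delta]) measurable
    then show ?thesis
      using char_Delta_tendsto[of t] by (simp only: char_std_mvn)
  qed
  fix e :: real assume e: "e > 0"
  define K where "K = sqrt (DIM('a) / e)"
  have K: "K > 0" "DIM('a) / K\<^sup>2 = e" using e by (auto simp: K_def)
  have "eventually (\<lambda>n. measure (?D n) {x. norm x > K} \<le> e) sequentially"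
    using eventually_ge_at_top[of 1] by eventually_elim (use Delta_tail[OF _ K(1), where 'a='a] K(2) in simp)
  then show "\<exists>K. eventually (\<lambda>n. measure (?D n) {x. norm x > K} \<le> e) sequentially" ..
qed (simp_all add: prob_space_std_mvn sets_std_mvn)

theorem theorem4p1:
  fixes \<tau> \<mu> :: "nat \<Rightarrow> real ^ 'p"
    and f :: "real \<Rightarrow> real"
  assumes p_ge_2: "CARD('p) \<ge> 2"
    and mu: "\<And>n. n \<ge> 1 \<Longrightarrow> \<mu> n = sqrt (real CARD('p) / real n) *\<^sub>R \<tau> n"
    and tau_O1: "(\<lambda>n. norm (\<tau> n)) \<in> O(\<lambda>_. 1)"
    and tau_not_o1: "(\<lambda>n. norm (\<tau> n)) \<notin> o(\<lambda>_. 1)"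
    and f_pos: "\<And>x. f x > 0"
    and f_mono: "strict_mono f"
    and f_0: "f 0 = 1"
    and f_deriv_0: "(f has_real_derivative 1) (at 0)"
    and f_diff_near_0: "eventually (\<lambda>x. f differentiable (at x)) (nhds 0)"
    and f_twice_diff_0: "deriv f differentiable (at 0)"
  shows "small_oP1 P_null
           (\<lambda>n \<omega>. log_likelihood_ratio (P_loc n (\<mu> n) f) (P_null n) \<omega>
                    - (\<tau> n \<bullet> Delta n \<omega> - 1 / 2 * (norm (\<tau> n))\<^sup>2))
       \<and> weak_conv_to (\<lambda>n. distr (P_null n) borel (Delta n)) (std_mvn :: (real ^ 'p) measure)"
proof
  obtain C where C: "eventually (\<lambda>n. norm (\<tau> n) \<le> C) sequentially"
    using tau_O1 by (elim landau_o.bigE) auto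
  \<comment> \<open>\<open>deriv\<close> is total, and is a genuine derivative only where
    \<open>f\<close> is differentiable; the neighbourhood hypothesis secures this around 0.\<close>
  have f': "eventually (\<lambda>x. (f has_real_derivative deriv f x) (at x)) (nhds 0)"
    using f_diff_near_0
    by eventually_elim (simp add: DERIV_deriv_iff_real_differentiable)
  have "(deriv f has_real_derivative deriv (deriv f) 0) (at 0)"
    using f_twice_diff_0 by (simp add: DERIV_deriv_iff_real_differentiable)
  then show "small_oP1 P_null
       (\<lambda>n \<omega>. log_likelihood_ratio (P_loc n (\<mu> n) f) (P_null n) \<omega>
                - (\<tau> n \<bullet> Delta n \<omega> - 1 / 2 * (norm (\<tau> n))\<^sup>2))"
    using mu C f_pos f_mono f_0 f' DERIV_imp_deriv[OF f_deriv_0]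
    by (intro log_likelihood_ratio_expansion[where f'="deriv f" and a="deriv (deriv f) 0" and C=C]) auto
qed (rule weak_conv_to_Delta)

end
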